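(* Let $(X,\mathcal{B},\mu,T)$ be an ergodic measure preserving system with finite positive entropy, and let $\mathcal{B}_0\subset\mathcal{B}$ be a $T$-invariant sub-$\sigma$-algebra that has full entropy. Then for a generic set of measurable subsets $A\subset X$ the partition $\mathcal{P}=\{A,X\setminus A\}$ satisfies $$\mathcal{B}=\mathcal{B}_0\vee\Big(\bigvee_{n=-\infty}^{\infty}T^{-n}\mathcal{P}\Big),$$ i.e. $\mathcal{P}$ is a relative generator.
   Context: $(X,\mathcal{B},\mu)$ is a standard probability space and $T$ is an invertible, $\mu$-preserving, ergodic transformation. $\mathcal{B}_0$ has full entropy if the entropy of the factor system $(X,\mathcal{B}_0,\mu,T)$ equals the entropy of $(X,\mathcal{B},\mu,T)$. Equalities of $\sigma$-algebras are modulo null sets. The space of measurable subsets (modulo null sets) is a complete separable metric space under $d(A,A')=\mu(A\triangle A')$; a generic set is one containing a dense $G_\delta$ subset of this space. *)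

theory Defs
  imports "HOL-Probability.Probability"
begin

section \<open>Standard probability spaces\<close>

definition iso_mod_null :: "'a measure \<Rightarrow> 'b measure \<Rightarrow> bool" where
  "iso_mod_null M N \<longleftrightarrow>
    (\<exists>X0 Y0 f. X0 \<in> sets M \<and> space M - X0 \<in> null_sets M \<and>
       Y0 \<in> sets N \<and> space N - Y0 \<in> null_sets N \<and>
       bij_betw f X0 Y0 \<and>
       f \<in> restrict_space M X0 \<rightarrow>\<^sub>M restrict_space N Y0 \<and>
       the_inv_into X0 f \<in> restrict_space N Y0 \<rightarrow>\<^sub>M restrict_space M X0 \<and>
       distr (restrict_space M X0) (restrict_space N Y0) f = restrict_space N Y0)"

text \<open>
  Both sides are completed, so that the notion covers the two usual conventions: Borel
  probability measures on standard Borel spaces, and their completions (Lebesgue spaces).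
  Atoms are allowed.
\<close>

definition standard_prob_space :: "'a measure \<Rightarrow> bool" where
  "standard_prob_space M \<longleftrightarrow>
    prob_space M \<and>
    (\<exists>\<nu> :: real measure. prob_space \<nu> \<and> sets \<nu> = sets borel \<and>
       iso_mod_null (completion M) (completion \<nu>))"


section \<open>Ergodic systems\<close>

locale ergodic_system = prob_space M
  for M :: "'a measure" and T :: "'a \<Rightarrow> 'a" +
  assumes T_bij: "bij_betw T (space M) (space M)"
    and T_measurable: "T \<in> M \<rightarrow>\<^sub>M M"
    and T_inv_measurable: "the_inv_into (space M) T \<in> M \<rightarrow>\<^sub>M M"
    and T_preserves: "\<And>A. A \<in> sets M \<Longrightarrow> emeasure M (T -` A \<inter> space M) = emeasure M A"
    and T_ergodic: "\<And>A. A \<in> sets M \<Longrightarrow> T -` A \<inter> space M = A \<Longrightarrow> prob A = 0 \<or> prob A = 1"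


section \<open>Families of measurable sets modulo null sets\<close>

definition eq_mod_null :: "'a measure \<Rightarrow> 'a set set \<Rightarrow> 'a set set \<Rightarrow> bool" where
  "eq_mod_null M \<A> \<C> \<longleftrightarrow>
    (\<forall>A\<in>\<A>. \<exists>C\<in>\<C>. sym_diff A C \<in> null_sets M) \<and>
    (\<forall>C\<in>\<C>. \<exists>A\<in>\<A>. sym_diff A C \<in> null_sets M)"

definition invariant_subalgebra :: "'a measure \<Rightarrow> ('a \<Rightarrow> 'a) \<Rightarrow> 'a measure \<Rightarrow> bool" where
  "invariant_subalgebra M T N \<longleftrightarrow>
    subalgebra M N \<and> eq_mod_null M ((\<lambda>A. T -` A \<inter> space M) ` sets N) (sets N)"


section \<open>Entropy\<close>

definition measurable_partitions :: "'a measure \<Rightarrow> 'a set set set" where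
  "measurable_partitions N = {P. finite P \<and> P \<subseteq> sets N \<and> partition_on (space N) P}"

text \<open>Since \<^term>\<open>ln 0 = (0::real)\<close>, null cells contribute nothing.\<close>

definition partition_entropy :: "'a measure \<Rightarrow> 'a set set \<Rightarrow> real" where
  "partition_entropy M P = - (\<Sum>A\<in>P. measure M A * ln (measure M A))"

text \<open>The join of the partitions \<open>T\<^sup>-\<^sup>i P\<close> for \<open>0 \<le> i < n\<close>; the degenerate case \<open>n = 0\<close> plays no role.\<close>

definition iterated_join :: "'a measure \<Rightarrow> ('a \<Rightarrow> 'a) \<Rightarrow> 'a set set \<Rightarrow> nat \<Rightarrow> 'a set set" where
  "iterated_join M T P n =
     common_refinement ((\<lambda>i. (\<lambda>A. (T ^^ i) -` A \<inter> space M) ` P) ` {..<n})"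

definition entropy_wrt_partition :: "'a measure \<Rightarrow> ('a \<Rightarrow> 'a) \<Rightarrow> 'a set set \<Rightarrow> real" where
  "entropy_wrt_partition M T P =
     lim (\<lambda>n. partition_entropy M (iterated_join M T P n) / real n)"

text \<open>
  The entropy of the factor system given by a sub-\<open>\<sigma>\<close>-algebra \<open>N\<close>. Only the sets of \<open>N\<close>
  matter; all measures are taken in \<open>M\<close>, as \<open>N\<close> need only be invariant modulo null sets.
\<close>

definition factor_entropy :: "'a measure \<Rightarrow> ('a \<Rightarrow> 'a) \<Rightarrow> 'a measure \<Rightarrow> ereal" where
  "factor_entropy M T N = (\<Squnion>P\<in>measurable_partitions N. ereal (entropy_wrt_partition M T P))"

definition system_entropy :: "'a measure \<Rightarrow> ('a \<Rightarrow> 'a) \<Rightarrow> ereal" where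
  "system_entropy M T = factor_entropy M T M"

definition full_entropy :: "'a measure \<Rightarrow> ('a \<Rightarrow> 'a) \<Rightarrow> 'a measure \<Rightarrow> bool" where
  "full_entropy M T N \<longleftrightarrow> factor_entropy M T N = system_entropy M T"


section \<open>Relative generators\<close>

text \<open>\<open>T\<^sup>-\<^sup>n A\<close> for an integer \<open>n\<close>, where \<open>T\<close> is a bijection of \<^term>\<open>space M\<close>.\<close>

definition int_preimage :: "'a measure \<Rightarrow> ('a \<Rightarrow> 'a) \<Rightarrow> int \<Rightarrow> 'a set \<Rightarrow> 'a set" where
  "int_preimage M T n A =
     (if n \<ge> 0 then (T ^^ nat n) -` A \<inter> space M else (T ^^ nat (- n)) ` A)"

definition two_sided_join :: "'a measure \<Rightarrow> ('a \<Rightarrow> 'a) \<Rightarrow> 'a set set \<Rightarrow> 'a set set" where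
  "two_sided_join M T P = sigma_sets (space M) (\<Union>n::int. int_preimage M T n ` P)"

definition relative_generator :: "'a measure \<Rightarrow> ('a \<Rightarrow> 'a) \<Rightarrow> 'a measure \<Rightarrow> 'a set set \<Rightarrow> bool" where
  "relative_generator M T N P \<longleftrightarrow>
     eq_mod_null M (sets M) (sigma_sets (space M) (sets N \<union> two_sided_join M T P))"


section \<open>The metric space of measurable sets modulo null sets\<close>

definition null_equiv :: "'a measure \<Rightarrow> ('a set \<times> 'a set) set" where
  "null_equiv M = {(A, B). A \<in> sets M \<and> B \<in> sets M \<and> sym_diff A B \<in> null_sets M}"

definition measure_algebra :: "'a measure \<Rightarrow> 'a set set set" where
  "measure_algebra M = sets M // null_equiv M"

text \<open>By \<open>measure_algebra_dist_class\<close> below, the choice of representatives is immaterial.\<close>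

definition measure_algebra_dist :: "'a measure \<Rightarrow> 'a set set \<Rightarrow> 'a set set \<Rightarrow> real" where
  "measure_algebra_dist M a b = measure M (sym_diff (SOME A. A \<in> a) (SOME B. B \<in> b))"

lemma equiv_null_equiv: "equiv (sets M) (null_equiv M)"
proof (rule equivI)
  show "null_equiv M \<subseteq> sets M \<times> sets M"
    by (auto simp: null_equiv_def)
  show "refl_on (sets M) (null_equiv M)"
    by (auto simp: null_equiv_def refl_on_def)
  show "sym (null_equiv M)"
    by (auto simp: null_equiv_def sym_def Un_commute)
  show "trans (null_equiv M)"
  proof (rule transI)
    fix A B C assume "(A, B) \<in> null_equiv M" "(B, C) \<in> null_equiv M"
    then have *: "A \<in> sets M" "B \<in> sets M" "C \<in> sets M"
      "sym_diff A B \<union> sym_diff B C \<in> null_sets M"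
      by (auto simp: null_equiv_def simp del: Un_iff)
    have "sym_diff A C \<in> null_sets M"
      by (rule null_sets_subset[OF *(4)]) (use *(1-3) in auto)
    with * show "(A, C) \<in> null_equiv M"
      by (simp add: null_equiv_def)
  qed
qed

context prob_space
begin

lemma prob_sym_diff_triangle:
  assumes "A \<in> events" "B \<in> events" "C \<in> events"
  shows "prob (sym_diff A C) \<le> prob (sym_diff A B) + prob (sym_diff B C)"
proof -
  have "prob (sym_diff A C) \<le> prob (sym_diff A B \<union> sym_diff B C)"
    by (rule finite_measure_mono) (use assms in auto)
  also have "\<dots> \<le> prob (sym_diff A B) + prob (sym_diff B C)"
    by (rule measure_Un_le) (use assms in auto)
  finally show ?thesis .
qed

lemma null_equiv_iff:
  assumes "A \<in> events" "B \<in> events"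
  shows "(A, B) \<in> null_equiv M \<longleftrightarrow> prob (sym_diff A B) = 0"
  using assms by (auto simp: null_equiv_def null_sets_def emeasure_eq_measure simp del: measure_Un_null_set)

lemma measure_algebra_dist_class:
  assumes "A \<in> events" "B \<in> events"
  shows "measure_algebra_dist M (null_equiv M `` {A}) (null_equiv M `` {B}) = prob (sym_diff A B)"
proof -
  have "prob (sym_diff A' B') = prob (sym_diff A B)"
    if "(A, A') \<in> null_equiv M" "(B, B') \<in> null_equiv M" for A' B'
  proof -
    from that have e: "A' \<in> events" "B' \<in> events"
      by (auto simp: null_equiv_def)
    have z: "prob (sym_diff A A') = 0" "prob (sym_diff B B') = 0"
      using that assms e by (simp_all only: null_equiv_iff)
    then have z': "prob (sym_diff A' A) = 0" "prob (sym_diff B' B) = 0"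
      by (simp_all only: Un_commute)
    show ?thesis
      using prob_sym_diff_triangle[of A A' B] prob_sym_diff_triangle[of A' B' B]
        prob_sym_diff_triangle[of A' A B'] prob_sym_diff_triangle[of A B B'] assms e z z'
      by linarith
  qed
  moreover have "(A, SOME A'. A' \<in> null_equiv M `` {A}) \<in> null_equiv M"
    "(B, SOME B'. B' \<in> null_equiv M `` {B}) \<in> null_equiv M"
    using someI[of "\<lambda>A'. A' \<in> null_equiv M `` {A}" A]
      someI[of "\<lambda>B'. B' \<in> null_equiv M `` {B}" B] assms
    by (auto simp: null_equiv_def)
  ultimately show ?thesis
    by (simp only: measure_algebra_dist_def)
qed

lemma Metric_space_measure_algebra:
  "Metric_space (measure_algebra M) (measure_algebra_dist M)"
proof
  show "0 \<le> measure_algebra_dist M a b" for a b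
    by (simp only: measure_algebra_dist_def measure_nonneg)
  show "measure_algebra_dist M a b = measure_algebra_dist M b a" for a b
    by (simp only: measure_algebra_dist_def Un_commute)
  show "measure_algebra_dist M a b = 0 \<longleftrightarrow> a = b"
    if a: "a \<in> measure_algebra M" and b: "b \<in> measure_algebra M" for a b
  proof -
    from a obtain A where A: "A \<in> events" "a = null_equiv M `` {A}"
      unfolding measure_algebra_def by (rule quotientE)
    from b obtain B where B: "B \<in> events" "b = null_equiv M `` {B}"
      unfolding measure_algebra_def by (rule quotientE)
    have "a = b \<longleftrightarrow> (A, B) \<in> null_equiv M"
      using eq_equiv_class_iff[OF equiv_null_equiv] A B by blast
    then show ?thesis
      using A B by (simp only: measure_algebra_dist_class null_equiv_iff)
  qed
  show "measure_algebra_dist M a c \<le> measure_algebra_dist M a b + measure_algebra_dist M b c"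
    if a: "a \<in> measure_algebra M" and b: "b \<in> measure_algebra M" and c: "c \<in> measure_algebra M"
    for a b c
  proof -
    from a obtain A where A: "A \<in> events" "a = null_equiv M `` {A}"
      unfolding measure_algebra_def by (rule quotientE)
    from b obtain B where B: "B \<in> events" "b = null_equiv M `` {B}"
      unfolding measure_algebra_def by (rule quotientE)
    from c obtain C where C: "C \<in> events" "c = null_equiv M `` {C}"
      unfolding measure_algebra_def by (rule quotientE)
    show ?thesis
      using A B C prob_sym_diff_triangle by (simp only: measure_algebra_dist_class)
  qed
qed

end

text \<open>A set of points is generic if it contains a dense \<open>G\<^sub>\<delta>\<close> set.\<close>

definition generic_in :: "'b topology \<Rightarrow> 'b set \<Rightarrow> bool" where
  "generic_in X S \<longleftrightarrow>
     S \<subseteq> topspace X \<and> (\<exists>G\<subseteq>S. gdelta_in X G \<and> X closure_of G = topspace X)"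

definition measure_algebra_topology :: "'a measure \<Rightarrow> 'a set set topology" where
  "measure_algebra_topology M =
     Metric_space.mtopology (measure_algebra M) (measure_algebra_dist M)"

end

theory Submission
  imports Defs
begin

text \<open>
  A set \<open>A\<close> is a relative generator iff each member of a countable generating family can be
  approximated in measure by sets of \<open>B0 \<squnion> (\<Squnion>\<^sub>n T\<^sup>-\<^sup>n{A, X - A})\<close>. For a fixed member \<open>B\<close> and precision
  \<open>e\<close> this is an open condition on \<open>A\<close>, so by Baire it remains to see that it is dense.

  By full entropy there is a finite \<open>B0\<close>-measurable partition relative to which the \<open>n\<close>-names of \<open>B\<close>
  have conditional entropy at most \<open>g\<^sup>2n\<close>; by Markov's inequality, given the \<open>B0\<close>-name, most points
  have one of at most \<open>exp (gn)\<close> names of \<open>B\<close>. Now take a Rokhlin tower of height \<open>n\<close> with base in \<open>B0\<close>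
  and change \<open>A\<close> on its lowest \<open>O(gn)\<close> levels only, writing there in binary the index of the \<open>B\<close>-name of
  the base point. Since \<open>B0\<close> knows the tower, \<open>B\<close> can be read off from \<open>B0\<close> and the modified \<open>A\<close>.
\<close>


section \<open>The measure algebra\<close>

text \<open>Typicality is controlled for the whole measure, but the coding happens at the points of
  a tower base, a set of measure at most 1/n; a base chosen blindly could consist of atypical points
  only. Hence n disjoint bases are built together, one per residue modulo n of the hitting time of a
  small set, and one of them meets the atypical set in at most an average share.

  A base in B0 requires small sets of positive measure in B0. They exist because full entropy makes
  the entropy of the factor positive, whereas a factor whose non-null sets have measure bounded
  below has entropy zero. Finiteness of the entropy lets the conditional entropy per step be read as
  a difference of two limits. So Markov's inequality for the conditional information takes the place
  of the Shannon-McMillan theorem, and ergodicity enters only through recurrence.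

  B0 is invariant only modulo null sets. Therefore B0, and the sigma-algebra that it generates
  together with A, are saturated by null sets before the dynamics act on them.\<close>

definition null_closure :: "'a measure \<Rightarrow> 'a set set \<Rightarrow> 'a set set" where
  "null_closure M S = {A \<in> sets M. \<exists>C\<in>S. sym_diff A C \<in> null_sets M}"

lemma null_closure_subset: "null_closure M S \<subseteq> sets M"
  by (auto simp: null_closure_def)

lemma subset_null_closure: "S \<subseteq> sets M \<Longrightarrow> S \<subseteq> null_closure M S"
  by (auto simp: null_closure_def intro!: bexI)

lemma null_closureI:
  "A \<in> sets M \<Longrightarrow> C \<in> S \<Longrightarrow> sym_diff A C \<in> null_sets M \<Longrightarrow> A \<in> null_closure M S"
  by (auto simp: null_closure_def)

lemma null_closureE:
  assumes "A \<in> null_closure M S"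
  obtains C where "A \<in> sets M" "C \<in> S" "sym_diff A C \<in> null_sets M"
  using assms by (auto simp: null_closure_def)

lemma null_closure_mono: "S \<subseteq> S' \<Longrightarrow> null_closure M S \<subseteq> null_closure M S'"
  by (auto simp: null_closure_def)

lemma null_sets_sym_diff_trans:
  assumes "sym_diff A B \<in> null_sets M" "sym_diff B C \<in> null_sets M"
    and "A \<in> sets M" "C \<in> sets M"
  shows "sym_diff A C \<in> null_sets M"
proof -
  have "sym_diff A B \<union> sym_diff B C \<in> null_sets M"
    using assms(1,2) by (rule null_sets.Un)
  then show ?thesis
    by (rule null_sets_subset) (use assms(3,4) in auto)
qed

lemma null_closure_idem:
  assumes "A \<in> sets M" "C \<in> null_closure M S" "sym_diff A C \<in> null_sets M" "S \<subseteq> sets M"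
  shows "A \<in> null_closure M S"
proof -
  from assms(2) obtain D where "C \<in> sets M" "D \<in> S" "sym_diff C D \<in> null_sets M"
    by (rule null_closureE)
  with assms show ?thesis
    by (intro null_closureI[of A M D] null_sets_sym_diff_trans[of A C M D]) auto
qed

lemma sigma_algebra_null_closure:
  assumes "sigma_algebra (space M) S" "S \<subseteq> sets M"
  shows "sigma_algebra (space M) (null_closure M S)"
  unfolding sigma_algebra_iff2
proof (intro conjI allI impI ballI)
  interpret S: sigma_algebra "space M" S by fact
  show "null_closure M S \<subseteq> Pow (space M)"
    using sets.sets_into_space null_closure_subset by blast
  show "{} \<in> null_closure M S"
    using subset_null_closure[OF assms(2)] S.empty_sets by blast
  fix A assume "A \<in> null_closure M S"
  then obtain C where C: "A \<in> sets M" "C \<in> S" "sym_diff A C \<in> null_sets M"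
    by (rule null_closureE)
  have "sym_diff (space M - A) (space M - C) = sym_diff A C"
    using C(1,2) assms(2) sets.sets_into_space by blast
  with C show "space M - A \<in> null_closure M S"
    by (intro null_closureI[of _ M "space M - C"]) auto
next
  interpret S: sigma_algebra "space M" S by fact
  fix A :: "nat \<Rightarrow> 'a set" assume "range A \<subseteq> null_closure M S"
  then have "\<forall>i. A i \<in> sets M \<and> (\<exists>C\<in>S. sym_diff (A i) C \<in> null_sets M)"
    by (auto simp: null_closure_def)
  then obtain C where C: "\<And>i. A i \<in> sets M" "\<And>i. C i \<in> S" "\<And>i. sym_diff (A i) (C i) \<in> null_sets M"
    by metis
  have "(\<Union>i. sym_diff (A i) (C i)) \<in> null_sets M"
    using C(3) by (rule null_sets_UN)
  then have "sym_diff (\<Union>i. A i) (\<Union>i. C i) \<in> null_sets M"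
  proof (rule null_sets_subset)
    show "sym_diff (\<Union>i. A i) (\<Union>i. C i) \<in> sets M"
      using C(1,2) assms(2) by (intro sets.Un sets.Diff sets.countable_UN) auto
  qed blast
  then show "(\<Union>i. A i) \<in> null_closure M S"
    using C(1,2) by (intro null_closureI[of _ M "\<Union>i. C i"]) auto
qed

text \<open>Every member of \<open>S\<close> is its own approximant in \<open>sets M\<close>, so
  only one direction carries content.\<close>

lemma eq_mod_null_sets_iff:
  assumes "S \<subseteq> sets M"
  shows "eq_mod_null M (sets M) S \<longleftrightarrow> sets M \<subseteq> null_closure M S"
proof -
  have "\<exists>A\<in>sets M. sym_diff A C \<in> null_sets M" if "C \<in> S" for C
    using that assms by (intro bexI[of _ C]) auto
  then show ?thesis
    unfolding eq_mod_null_def null_closure_def by blast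
qed

section \<open>Convergence, completeness and continuity in the measure algebra\<close>

context prob_space
begin

lemma null_sets_iff_prob: "A \<in> events \<Longrightarrow> A \<in> null_sets M \<longleftrightarrow> prob A = 0"
  by (auto simp: null_sets_def emeasure_eq_measure)

text \<open>A point outside all the consecutive symmetric differences from \<open>m\<close> on never
  changes its membership again, so \<open>A m\<close> and the lower limit agree there. What remains
  is the tail of a geometric series.\<close>

lemma prob_sym_diff_liminf:
  assumes A: "\<And>k. A k \<in> events"
    and le: "\<And>k. prob (sym_diff (A k) (A (Suc k))) \<le> (1/2) ^ k"
  shows "prob (sym_diff (A m) (\<Union>m. \<Inter>k\<in>{m..}. A k)) \<le> 2 * (1/2) ^ m"
proof -
  define E where "E i = sym_diff (A (m + i)) (A (Suc (m + i)))" for i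
  have E: "E i \<in> events" for i
    using A by (auto simp: E_def)
  have pE: "prob (E i) \<le> (1/2) ^ m * (1/2) ^ i" for i
    using le[of "m + i"] by (simp add: E_def power_add)
  have geo: "(\<lambda>i. (1/2) ^ m * (1/2) ^ i :: real) sums ((1/2) ^ m * (1 / (1 - 1/2)))"
    by (intro sums_mult geometric_sums) simp
  have sm: "summable (\<lambda>i. prob (E i))"
    by (rule summable_comparison_test[OF _ sums_summable[OF geo]]) (use pE in auto)
  have "sym_diff (A m) (\<Union>m. \<Inter>k\<in>{m..}. A k) \<subseteq> (\<Union>i. E i)"
  proof (rule ccontr)
    assume "\<not> ?thesis"
    then obtain x where x: "x \<in> sym_diff (A m) (\<Union>m. \<Inter>k\<in>{m..}. A k)" and n: "\<And>i. x \<notin> E i"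
      by blast
    have const: "x \<in> A (m + i) \<longleftrightarrow> x \<in> A m" for i
      by (induction i) (use n in \<open>auto simp: E_def\<close>)
    then have const': "x \<in> A k \<longleftrightarrow> x \<in> A m" if "k \<ge> m" for k
      using const[of "k - m"] that by simp
    have "x \<in> A m \<longleftrightarrow> x \<in> (\<Union>m. \<Inter>k\<in>{m..}. A k)"
    proof
      assume "x \<in> (\<Union>m. \<Inter>k\<in>{m..}. A k)"
      then obtain m' where "\<And>k. k \<ge> m' \<Longrightarrow> x \<in> A k" by auto
      then have "x \<in> A (max m m')" by simp
      with const'[of "max m m'"] show "x \<in> A m" by simp
    next
      assume x: "x \<in> A m"
      have "x \<in> A k" if "k \<ge> m" for k
        using const'[OF that] x by blast
      then show "x \<in> (\<Union>m. \<Inter>k\<in>{m..}. A k)"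
        by auto
    qed
    with x show False by auto
  qed
  then have "prob (sym_diff (A m) (\<Union>m. \<Inter>k\<in>{m..}. A k)) \<le> prob (\<Union>i. E i)"
    by (rule finite_measure_mono) (use E in auto)
  also have "\<dots> \<le> (\<Sum>i. prob (E i))"
    by (rule finite_measure_subadditive_countably) (use E sm in auto)
  also have "\<dots> \<le> (\<Sum>i. (1/2) ^ m * (1/2) ^ i)"
    using sm geo pE by (intro suminf_le) (auto simp: sums_iff)
  also have "\<dots> = 2 * (1/2) ^ m"
    using geo by (simp add: sums_iff)
  finally show ?thesis .
qed

text \<open>The lower limit of a fast approximating sequence stays in the sigma-algebra and differs
  from \<open>B\<close> by a null set.\<close>

lemma null_closure_closed:
  assumes S: "sigma_algebra (space M) S" "S \<subseteq> events" and B: "B \<in> events"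
    and approx: "\<And>e. e > 0 \<Longrightarrow> \<exists>D\<in>null_closure M S. prob (sym_diff B D) < e"
  shows "B \<in> null_closure M S"
proof -
  interpret C: sigma_algebra "space M" "null_closure M S"
    using S by (rule sigma_algebra_null_closure)
  \<comment> \<open>The extra factor 1/2 leaves room for the triangle inequality: consecutive
    members are then within \<open>(1/2) ^ k\<close>.\<close>
  have "\<exists>D\<in>null_closure M S. prob (sym_diff B D) < (1/2) ^ k / 2" for k
    by (rule approx) simp
  then obtain D where D: "\<And>k. D k \<in> null_closure M S" "\<And>k. prob (sym_diff B (D k)) < (1/2) ^ k / 2"
    by metis
  have DM: "D k \<in> events" for k
    using D(1) null_closure_subset by blast
  have st: "prob (sym_diff (D k) (D (Suc k))) \<le> (1/2) ^ k" for k
  proof -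
    have "prob (sym_diff (D k) (D (Suc k))) \<le> prob (sym_diff (D k) B) + prob (sym_diff B (D (Suc k)))"
      using DM B by (intro prob_sym_diff_triangle)
    also have "\<dots> \<le> (1/2) ^ k / 2 + (1/2) ^ Suc k / 2"
      using D(2)[of k] D(2)[of "Suc k"] by (simp add: Un_commute)
    finally show ?thesis
      using zero_le_power[of "1/2::real" k] unfolding power_Suc by linarith
  qed
  define L where "L = (\<Union>m. \<Inter>k\<in>{m..}. D k)"
  have L: "L \<in> null_closure M S"
    unfolding L_def using D(1) by (intro C.countable_UN C.countable_INT'') auto
  then have LM: "L \<in> events"
    using null_closure_subset by blast
  have "prob (sym_diff B L) \<le> 3 * (1/2) ^ m" for m
  proof -
    have "prob (sym_diff B L) \<le> prob (sym_diff B (D m)) + prob (sym_diff (D m) L)"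
      using DM B LM by (intro prob_sym_diff_triangle)
    moreover have "prob (sym_diff (D m) L) \<le> 2 * (1/2) ^ m"
      unfolding L_def using DM st by (rule prob_sym_diff_liminf)
    ultimately show ?thesis
      using D(2)[of m] zero_le_power[of "1/2::real" m] by linarith
  qed
  moreover have "(\<lambda>m. 3 * (1/2::real) ^ m) \<longlonglongrightarrow> 3 * 0"
    by (intro tendsto_mult tendsto_const LIMSEQ_power_zero) simp
  ultimately have "prob (sym_diff B L) \<le> 0"
    by (intro LIMSEQ_le_const[of "\<lambda>m. 3 * (1/2::real) ^ m"]) auto
  then have "prob (sym_diff B L) = 0"
    using measure_nonneg[of M "sym_diff B L"] by linarith
  moreover have "sym_diff B L \<in> events"
    using B LM by auto
  ultimately have "sym_diff B L \<in> null_sets M"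
    using null_sets_iff_prob by blast
  then show ?thesis
    using B L S(2) by (intro null_closure_idem[of B M L])
qed

lemma mcomplete_measure_algebra:
  "Metric_space.mcomplete (measure_algebra M) (measure_algebra_dist M)"
proof -
  interpret MA: Metric_space "measure_algebra M" "measure_algebra_dist M"
    by (rule Metric_space_measure_algebra)
  show ?thesis
    unfolding MA.mcomplete_def
  proof (intro allI impI)
    fix \<sigma> assume \<sigma>: "MA.MCauchy \<sigma>"
    then have "\<exists>N. \<forall>n\<ge>N. \<forall>n'\<ge>N. measure_algebra_dist M (\<sigma> n) (\<sigma> n') < (1/2) ^ k" for k
      unfolding MA.MCauchy_def by simp
    then obtain N where N: "\<And>k n n'. n \<ge> N k \<Longrightarrow> n' \<ge> N k \<Longrightarrow>
        measure_algebra_dist M (\<sigma> n) (\<sigma> n') < (1/2) ^ k"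
      by metis
    have "\<forall>n. \<exists>A\<in>events. \<sigma> n = null_equiv M `` {A}"
    proof
      fix n
      from \<sigma> have "\<sigma> n \<in> measure_algebra M"
        by (auto simp: MA.MCauchy_def)
      then show "\<exists>A\<in>events. \<sigma> n = null_equiv M `` {A}"
        unfolding measure_algebra_def by (auto elim!: quotientE)
    qed
    then obtain A where A: "\<And>n. A n \<in> events" "\<And>n. \<sigma> n = null_equiv M `` {A n}"
      by metis
    have d: "measure_algebra_dist M (\<sigma> n) (null_equiv M `` {B}) = prob (sym_diff (A n) B)"
      if "B \<in> events" for n B
      unfolding A(2) by (rule measure_algebra_dist_class) (use A that in auto)
    \<comment> \<open>The running maximum makes \<open>r k'\<close> admissible for every precision
      \<open>k \<le> k'\<close>, so both \<open>r k\<close> and \<open>r (Suc k)\<close> lie beyond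
      \<open>N k\<close>.\<close>
    define r where "r k = Max (N ` {..k})" for k
    have rN: "r k' \<ge> N k" if "k \<le> k'" for k k'
      unfolding r_def by (rule Max_ge) (use that in auto)
    define L where "L = (\<Union>m. \<Inter>k\<in>{m..}. A (r k))"
    have L: "L \<in> events"
      unfolding L_def using A(1) by (intro sets.countable_UN sets.countable_INT'') auto
    have lim: "prob (sym_diff (A (r m)) L) \<le> 2 * (1/2) ^ m" for m
      unfolding L_def
    proof (rule prob_sym_diff_liminf)
      show "prob (sym_diff (A (r k)) (A (r (Suc k)))) \<le> (1/2) ^ k" for k
        using N[OF rN[of k k] rN[of k "Suc k"]] d[OF A(1)] A(2) by (simp add: less_imp_le)
    qed (use A in auto)
    show "\<exists>x. limitin MA.mtopology \<sigma> x sequentially"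
    proof (rule exI[of _ "null_equiv M `` {L}"], unfold MA.limit_metric_sequentially, intro conjI allI impI)
      show "null_equiv M `` {L} \<in> measure_algebra M"
        unfolding measure_algebra_def using L by (rule quotientI)
      fix e :: real assume "e > 0"
      then have "\<exists>m. (1/2) ^ m < e / 3"
        by (intro real_arch_pow_inv) auto
      then obtain m where m: "(1/2) ^ m < e / 3" ..
      show "\<exists>K. \<forall>n\<ge>K. \<sigma> n \<in> measure_algebra M \<and> measure_algebra_dist M (\<sigma> n) (null_equiv M `` {L}) < e"
      proof (intro exI[of _ "N m"] allI impI conjI)
        fix n assume n: "n \<ge> N m"
        show "\<sigma> n \<in> measure_algebra M"
          using \<sigma> by (auto simp: MA.MCauchy_def)
        have "prob (sym_diff (A n) L) \<le> prob (sym_diff (A n) (A (r m))) + prob (sym_diff (A (r m)) L)"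
          using A(1) L by (intro prob_sym_diff_triangle) auto
        moreover have "prob (sym_diff (A n) (A (r m))) < (1/2) ^ m"
          using N[OF n rN[of m m]] d[OF A(1)] A(2) by simp
        ultimately have "prob (sym_diff (A n) L) < e"
          using lim[of m] m by linarith
        then show "measure_algebra_dist M (\<sigma> n) (null_equiv M `` {L}) < e"
          using d[OF L] by simp
      qed
    qed
  qed
qed

text \<open>Each set generated from \<open>A\<close> by the operations \<open>G i\<close> is approximated by one that involves only
  finitely many of them, hence by the corresponding set for any \<open>A'\<close> close to \<open>A\<close>.\<close>

lemma sigma_sets_approx_continuous:
  fixes G :: "'i \<Rightarrow> 'a set \<Rightarrow> 'a set" and S :: "'a set set"
  defines "R \<equiv> \<lambda>A. sigma_sets (space M) (S \<union> range (\<lambda>i. G i A))"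
  assumes S: "S \<subseteq> events" and G: "\<And>i A. A \<in> events \<Longrightarrow> G i A \<in> events"
    and cont: "\<And>i A A'. A \<in> events \<Longrightarrow> A' \<in> events \<Longrightarrow> prob (sym_diff (G i A) (G i A')) \<le> prob (sym_diff A A')"
    and A: "A \<in> events" and D: "D \<in> R A" and "e > 0"
  shows "\<exists>\<delta>>0. \<forall>A'\<in>events. prob (sym_diff A A') < \<delta> \<longrightarrow> (\<exists>D'\<in>R A'. prob (sym_diff D D') < e)"
proof -
  have Rev: "R A' \<subseteq> events" if "A' \<in> events" for A'
    unfolding R_def using S G that by (intro sets.sigma_sets_subset) auto
  have sub: "S \<union> range (\<lambda>i. G i A') \<subseteq> Pow (space M)" if "A' \<in> events" for A'
  proof -
    have "S \<union> range (\<lambda>i. G i A') \<subseteq> events" using S G that by auto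
    then show ?thesis using sets.space_closed by blast
  qed
  have Ralg: "sigma_algebra (space M) (R A')" if "A' \<in> events" for A'
    unfolding R_def by (rule sigma_algebra_sigma_sets[OF sub[OF that]])
  from D[unfolded R_def] \<open>e > 0\<close> show ?thesis
  proof (induction arbitrary: e rule: sigma_sets.induct)
    case (Basic a)
    then consider "a \<in> S" | i where "a = G i A" by auto
    then show ?case
    proof cases
      case 1
      have "a \<in> R A'" for A'
        unfolding R_def using 1 by (intro sigma_sets.Basic) auto
      then show ?thesis
        using \<open>e > 0\<close> by (intro exI[of _ 1]) (auto intro!: bexI[of _ a])
    next
      case 2
      have m: "G i A' \<in> R A'" for A'
        unfolding R_def by (intro sigma_sets.Basic) auto
      show ?thesis
      proof (rule exI[of _ e], intro conjI ballI impI)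
        fix A' assume "A' \<in> events" "prob (sym_diff A A') < e"
        then show "\<exists>D'\<in>R A'. prob (sym_diff a D') < e"
          using cont[OF A, of A' i] m[of A'] 2 by (intro bexI[of _ "G i A'"]) auto
      qed fact
    qed
  next
    case Empty
    have "{} \<in> R A'" for A'
      unfolding R_def by (rule sigma_sets.Empty)
    then show ?case
      using Empty by (intro exI[of _ 1]) (auto intro!: bexI[of _ "{}"])
  next
    case (Compl a)
    from Compl.IH[OF \<open>e > 0\<close>] obtain \<delta> where \<delta>: "\<delta> > 0"
      "\<And>A'. A' \<in> events \<Longrightarrow> prob (sym_diff A A') < \<delta> \<Longrightarrow> \<exists>D'\<in>R A'. prob (sym_diff a D') < e"
      by blast
    have aM: "a \<in> events"
      using Compl.hyps Rev[OF A] by (auto simp: R_def)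
    show ?case
    proof (rule exI[of _ \<delta>], intro conjI ballI impI)
      fix A' assume A': "A' \<in> events" "prob (sym_diff A A') < \<delta>"
      from \<delta>(2)[OF A'] obtain D' where D': "D' \<in> R A'" "prob (sym_diff a D') < e" by blast
      have "sym_diff (space M - a) (space M - D') = sym_diff a D'"
        using aM D' Rev[OF A'(1)] sets.sets_into_space by blast
      moreover have "space M - D' \<in> R A'"
        using D'(1) unfolding R_def by (rule sigma_sets.Compl)
      ultimately show "\<exists>D'\<in>R A'. prob (sym_diff (space M - a) D') < e"
        using D'(2) by (intro bexI[of _ "space M - D'"]) auto
    qed fact
  next
    case (Union a)
    have aM: "a i \<in> events" for i
      using Union.hyps[of i] Rev[OF A] by (auto simp: R_def)
    have "(\<lambda>n. prob (\<Union>i<n. a i)) \<longlonglongrightarrow> prob (\<Union>n. \<Union>i<n. a i)"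
      using aM by (intro finite_Lim_measure_incseq incseq_SucI) (auto simp: lessThan_Suc)
    moreover have "(\<Union>n. \<Union>i<n. a i) = (\<Union>i. a i)"
      by blast
    ultimately have "(\<lambda>n. prob (\<Union>i<n. a i)) \<longlonglongrightarrow> prob (\<Union>i. a i)"
      by simp
    then have "\<forall>\<^sub>F n in sequentially. prob (\<Union>i. a i) - e / 2 < prob (\<Union>i<n. a i)"
      using \<open>e > 0\<close> by (intro order_tendstoD(1)) auto
    then obtain n where n: "prob (\<Union>i. a i) - e / 2 < prob (\<Union>i<n. a i)"
      by (auto simp: eventually_sequentially)
    have diff: "prob ((\<Union>i. a i) - (\<Union>i<n. a i)) < e / 2"
      using n aM by (subst finite_measure_Diff) auto
    \<comment> \<open>Half of \<open>e\<close> pays for truncating the union; the other half is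
      shared by the \<open>n\<close> remaining sets. The \<open>+ 1\<close> here, and
      \<open>{..n}\<close> instead of \<open>{..<n}\<close> in the minimum below, cover the case
      \<open>n = 0\<close>.\<close>
    have "\<forall>i. \<exists>\<delta>>0. \<forall>A'\<in>events. prob (sym_diff A A') < \<delta> \<longrightarrow>
        (\<exists>D'\<in>R A'. prob (sym_diff (a i) D') < e / (2 * (real n + 1)))"
      using Union.IH \<open>e > 0\<close> by (intro allI Union.IH) (auto simp: field_simps)
    then obtain \<delta> where \<delta>: "\<And>i. \<delta> i > 0" "\<And>i A'. A' \<in> events \<Longrightarrow> prob (sym_diff A A') < \<delta> i \<Longrightarrow>
        \<exists>D'\<in>R A'. prob (sym_diff (a i) D') < e / (2 * (real n + 1))"
      by metis
    show ?case
    proof (rule exI[of _ "Min (\<delta> ` {..n})"], intro conjI ballI impI)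
      show "Min (\<delta> ` {..n}) > 0"
        using \<delta>(1) by (subst Min_gr_iff) auto
      fix A' assume A': "A' \<in> events" "prob (sym_diff A A') < Min (\<delta> ` {..n})"
      have "\<exists>D'\<in>R A'. prob (sym_diff (a i) D') < e / (2 * (real n + 1))" if "i < n" for i
      proof (rule \<delta>(2)[OF A'(1)])
        have "Min (\<delta> ` {..n}) \<le> \<delta> i" using that by (intro Min_le) auto
        then show "prob (sym_diff A A') < \<delta> i" using A'(2) by linarith
      qed
      then have "\<forall>i. \<exists>D'. i < n \<longrightarrow> D' \<in> R A' \<and> prob (sym_diff (a i) D') < e / (2 * (real n + 1))"
        by blast
      then obtain D' where D': "\<And>i. i < n \<Longrightarrow> D' i \<in> R A'"
        "\<And>i. i < n \<Longrightarrow> prob (sym_diff (a i) (D' i)) < e / (2 * (real n + 1))"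
        by metis
      interpret R: sigma_algebra "space M" "R A'" by (rule Ralg[OF A'(1)])
      have U: "(\<Union>i<n. D' i) \<in> R A'"
        using D'(1) by auto
      have DM: "D' i \<in> events" if "i < n" for i
        using D'(1)[OF that] Rev[OF A'(1)] by blast
      have "prob (sym_diff (\<Union>i. a i) (\<Union>i<n. D' i))
          \<le> prob (((\<Union>i. a i) - (\<Union>i<n. a i)) \<union> (\<Union>i<n. sym_diff (a i) (D' i)))"
        using aM DM by (intro finite_measure_mono) auto
      also have "\<dots> \<le> prob ((\<Union>i. a i) - (\<Union>i<n. a i)) + prob (\<Union>i<n. sym_diff (a i) (D' i))"
        using aM DM by (intro measure_Un_le) auto
      also have "\<dots> \<le> prob ((\<Union>i. a i) - (\<Union>i<n. a i)) + (\<Sum>i<n. prob (sym_diff (a i) (D' i)))"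
        using aM DM by (intro add_left_mono measure_UNION_le) auto
      also have "\<dots> \<le> prob ((\<Union>i. a i) - (\<Union>i<n. a i)) + (\<Sum>i<n. e / (2 * (real n + 1)))"
        using D'(2) by (intro add_left_mono sum_mono) (auto intro: less_imp_le)
      also have "(\<Sum>i<n. e / (2 * (real n + 1))) \<le> e / 2"
        using \<open>e > 0\<close> by (auto simp: field_simps)
      finally have "prob (sym_diff (\<Union>i. a i) (\<Union>i<n. D' i)) < e"
        using diff by linarith
      with U show "\<exists>D'\<in>R A'. prob (sym_diff (\<Union>i. a i) D') < e"
        by blast
    qed
  qed
qed

end

section \<open>Countable generation of standard spaces\<close>

lemma null_completion_subset:
  "A \<subseteq> B \<Longrightarrow> B \<in> null_sets (completion M) \<Longrightarrow> A \<in> null_sets (completion M)"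
  by (rule completion.complete2)

lemma completion_null_approx:
  assumes "A \<in> sets (completion M)"
  obtains C where "C \<in> sets M" "sym_diff A C \<in> null_sets (completion M)"
proof -
  from assms obtain S N N' where "A = S \<union> N" "N \<subseteq> N'" "N' \<in> null_sets M" "S \<in> sets M"
    by (rule sets_completionE)
  then show thesis
    using null_completion_subset[of "sym_diff A S" N' M] null_sets_completionI
    by (intro that[of S]) blast+
qed

text \<open>A countable basis of the real line is pulled back along the isomorphism. The pullbacks
  lie only in the completion, so each is replaced by a set of \<open>M\<close> that differs from it
  by a null set.\<close>

lemma standard_prob_space_countably_generated:
  assumes "standard_prob_space M"
  obtains G :: "nat \<Rightarrow> 'a set"
  where "range G \<subseteq> sets M" "sets M \<subseteq> null_closure M (sigma_sets (space M) (range G))"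
proof -
  from assms obtain \<nu> :: "real measure" where \<nu>: "sets \<nu> = sets borel" "iso_mod_null (completion M) (completion \<nu>)"
    by (auto simp: standard_prob_space_def)
  define N V where "N = completion M" and "V = completion \<nu>"
  from \<nu>(2) obtain X0 Y0 f where
    X0: "X0 \<in> sets N" "space N - X0 \<in> null_sets N" and Y0: "Y0 \<in> sets V" and
    bij: "bij_betw f X0 Y0" and
    f: "f \<in> restrict_space N X0 \<rightarrow>\<^sub>M restrict_space V Y0" and
    g: "the_inv_into X0 f \<in> restrict_space V Y0 \<rightarrow>\<^sub>M restrict_space N X0" and
    d: "distr (restrict_space N X0) (restrict_space V Y0) f = restrict_space V Y0"
    unfolding iso_mod_null_def N_def V_def by blast
  have sub: "A \<in> null_sets N" if "A \<subseteq> B" "B \<in> null_sets N" for A B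
    using that unfolding N_def by (rule null_completion_subset)
  have X0N: "X0 \<subseteq> space N" using X0(1) by (rule sets.sets_into_space)
  have spN: "space N = space M" by (simp add: N_def)
  have inX: "A \<in> sets N" if "A \<in> sets (restrict_space N X0)" for A
    using that X0 sets_restrict_space_iff[of X0 N A] sets.Int[of X0 N "space N"] by blast
  have inY: "A \<in> sets V" if "A \<in> sets (restrict_space V Y0)" for A
    using that Y0 sets_restrict_space_iff[of Y0 V A] sets.Int[of Y0 V "space V"] by blast
  have fY: "f x \<in> Y0" if "x \<in> X0" for x using bij that by (auto simp: bij_betw_def)
  have pull: "f -` S \<inter> X0 \<in> sets N" if "S \<in> sets V" for S
  proof -
    have "Y0 \<inter> S \<in> sets (restrict_space V Y0)" using that by (auto simp: sets_restrict_space)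
    from inX[OF measurable_sets[OF f this]] have "f -` (Y0 \<inter> S) \<inter> X0 \<in> sets N"
      by (simp only: space_restrict_space2[OF X0(1)])
    moreover have "f -` (Y0 \<inter> S) \<inter> X0 = f -` S \<inter> X0" using fY by auto
    ultimately show ?thesis by simp
  qed
  \<comment> \<open>The only place where measure preservation of the isomorphism is used: it carries
    null sets of the target back to null sets.\<close>
  have pull_null: "f -` S \<inter> X0 \<in> null_sets N" if S: "S \<in> null_sets V" for S
  proof -
    have SV: "S \<in> sets V" using S by auto
    have YS: "Y0 \<inter> S \<in> sets (restrict_space V Y0)" using SV by (auto simp: sets_restrict_space)
    have eq: "f -` (Y0 \<inter> S) \<inter> X0 = f -` S \<inter> X0" using fY by auto
    have "emeasure N (f -` S \<inter> X0) = emeasure (restrict_space N X0) (f -` (Y0 \<inter> S) \<inter> X0)"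
      unfolding eq using X0 by (intro emeasure_restrict_space[symmetric]) auto
    also have "\<dots> = emeasure (distr (restrict_space N X0) (restrict_space V Y0) f) (Y0 \<inter> S)"
      using emeasure_distr[OF f YS] X0(1) by simp
    also have "\<dots> = emeasure (restrict_space V Y0) (Y0 \<inter> S)" by (simp only: d)
    also have "\<dots> = emeasure V (Y0 \<inter> S)"
      using Y0 by (intro emeasure_restrict_space) auto
    also have "\<dots> \<le> emeasure V S" using SV by (intro emeasure_mono) auto
    also have "\<dots> = 0" using S by auto
    finally show ?thesis using pull[OF SV] by (auto simp: null_sets_def)
  qed
  obtain B :: "real set set" where B: "countable B" "topological_basis B"
    using ex_countable_basis by blast
  have "B \<noteq> {}"
  proof
    assume "B = {}"
    then show False using topological_basisE[OF B(2) open_UNIV UNIV_I] by blast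
  qed
  define b where "b = from_nat_into B"
  have rb: "range b = B" unfolding b_def using \<open>B \<noteq> {}\<close> B(1) by (rule range_from_nat_into)
  have borel: "sets borel = sigma_sets UNIV (range b)"
    unfolding rb by (subst borel_eq_countable_basis[OF B]) simp
  have bV: "S \<in> sets V" if "S \<in> sets borel" for S
    using that \<nu>(1) by (simp add: V_def)
  have "\<forall>k. \<exists>C. C \<in> sets M \<and> sym_diff (f -` b k \<inter> X0) C \<in> null_sets N"
  proof
    fix k
    have "b k \<in> sets borel" unfolding borel by (rule sigma_sets.Basic) simp
    then have "f -` b k \<inter> X0 \<in> sets (completion M)" using pull bV by (simp add: N_def)
    then show "\<exists>C. C \<in> sets M \<and> sym_diff (f -` b k \<inter> X0) C \<in> null_sets N"
      unfolding N_def by (rule completion_null_approx) blast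
  qed
  then obtain G where G: "\<And>k. G k \<in> sets M" "\<And>k. sym_diff (f -` b k \<inter> X0) (G k) \<in> null_sets N"
    by metis
  let ?S = "sigma_sets (space M) (range G)"
  have rG: "range G \<subseteq> sets M" using G(1) by auto
  then have SM: "?S \<subseteq> sets M" by (rule sets.sigma_sets_subset)
  \<comment> \<open>The sets whose pullback agrees with a generated set up to a null set form a
    sigma-algebra; the complement case loses the null set \<open>space N - X0\<close>.\<close>
  have approx: "\<exists>C\<in>?S. sym_diff (f -` S \<inter> X0) C \<in> null_sets N" if "S \<in> sets borel" for S
    using that unfolding borel
  proof (induction rule: sigma_sets.induct)
    case (Basic a)
    then obtain k where "a = b k" by auto
    with G(2)[of k] show ?case by (intro bexI[of _ "G k"] sigma_sets.Basic) auto
  next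
    case Empty
    then show ?case by (intro bexI[of _ "{}"] sigma_sets.Empty) simp
  next
    case (Compl a)
    then obtain C where C: "C \<in> ?S" "sym_diff (f -` a \<inter> X0) C \<in> null_sets N" by blast
    have "sym_diff (f -` (UNIV - a) \<inter> X0) (space M - C) \<subseteq> sym_diff (f -` a \<inter> X0) C \<union> (space N - X0)"
      using X0N spN by auto
    from sub[OF this null_sets.Un[OF C(2) X0(2)]] C(1) show ?case
      by (intro bexI[of _ "space M - C"] sigma_sets.Compl)
  next
    case (Union a)
    then obtain C where C: "\<And>i. C i \<in> ?S" "\<And>i. sym_diff (f -` a i \<inter> X0) (C i) \<in> null_sets N"
      by metis
    have "sym_diff (f -` (\<Union>i. a i) \<inter> X0) (\<Union>i. C i) \<subseteq> (\<Union>i. sym_diff (f -` a i \<inter> X0) (C i))"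
      by blast
    from sub[OF this null_sets_UN[OF C(2)]] C(1) show ?case
      by (intro bexI[of _ "\<Union>i. C i"] sigma_sets.Union)
  qed
  have "A \<in> null_closure M ?S" if A: "A \<in> sets M" for A
  proof -
    have AN: "A \<in> sets N" using A by (simp add: N_def)
    \<comment> \<open>This is the image of \<open>A \<inter> X0\<close> under \<open>f\<close>,
      written as a preimage under the inverse so that its measurability follows.\<close>
    define S where "S = the_inv_into X0 f -` (X0 \<inter> A) \<inter> Y0"
    have "X0 \<inter> A \<in> sets (restrict_space N X0)" using AN by (auto simp: sets_restrict_space)
    from inY[OF measurable_sets[OF g this]] have SV: "S \<in> sets V"
      by (simp only: S_def space_restrict_space2[OF Y0])
    have inj: "inj_on f X0" using bij by (simp add: bij_betw_def)
    have fS: "f -` S \<inter> X0 = A \<inter> X0"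
      using fY the_inv_into_f_f[OF inj] by (auto simp: S_def)
    from SV obtain S1 where S1: "S1 \<in> sets \<nu>" "sym_diff S S1 \<in> null_sets V"
      unfolding V_def by (rule completion_null_approx)
    from approx[of S1] S1(1) \<nu>(1) obtain C where C: "C \<in> ?S" "sym_diff (f -` S1 \<inter> X0) C \<in> null_sets N"
      by auto
    have "sym_diff A C \<subseteq> (space N - X0) \<union> (f -` (sym_diff S S1) \<inter> X0) \<union> sym_diff (f -` S1 \<inter> X0) C"
      using fS sets.sets_into_space[OF AN] by blast
    from sub[OF this] have "sym_diff A C \<in> null_sets N"
      using pull_null[OF S1(2)] X0(2) C(2) by (blast intro: null_sets.Un)
    then have "sym_diff A C \<in> null_sets M"
      using A C(1) SM unfolding N_def by (subst (asm) null_sets_completion_iff) auto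
    with A C(1) show ?thesis by (intro null_closureI)
  qed
  with rG that show thesis by blast
qed


section \<open>Entropy of finite labellings\<close>

text \<open>The limit is the infimum of the quotients: writing \<open>n = q * k + r\<close> bounds
  \<open>a n / n\<close> by \<open>a k / k\<close> for a nearly optimal \<open>k\<close>, up to an
  error of order 1/n.\<close>

lemma fekete:
  fixes a :: "nat \<Rightarrow> real"
  assumes sub: "\<And>m n. a (m + n) \<le> a m + a n" and nonneg: "\<And>n. a n \<ge> 0"
  shows "convergent (\<lambda>n. a n / real n)"
proof -
  define L where "L = (INF n\<in>{1..}. a n / real n)"
  have bdd: "bdd_below ((\<lambda>n. a n / real n) ` {1..})"
    by (rule bdd_belowI[of _ 0]) (use nonneg in auto)
  have lower: "L \<le> a n / real n" if "n \<ge> 1" for n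
    unfolding L_def using bdd that by (intro cINF_lower) auto
  \<comment> \<open>The summand \<open>a 0\<close> is what starts the induction at
    \<open>q = 0\<close>, where subadditivity gives no upper bound.\<close>
  have mult: "a (q * k) \<le> real q * a k + a 0" for q k
  proof (induction q)
    case (Suc q)
    have "a (Suc q * k) \<le> a k + a (q * k)"
      using sub[of k "q * k"] by simp
    with Suc show ?case by (simp add: algebra_simps)
  qed simp
  have "(\<lambda>n. a n / real n) \<longlonglongrightarrow> L"
  proof (rule LIMSEQ_I)
    fix e :: real assume e: "e > 0"
    have "\<exists>k\<in>{1..}. a k / real k < L + e / 2"
      using e bdd unfolding L_def by (subst cINF_less_iff[symmetric]) auto
    then obtain k where k: "k \<ge> 1" "a k / real k < L + e / 2" by auto
    \<comment> \<open>One constant that dominates \<open>a 0\<close> together with any of the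
      remainders \<open>a r\<close>.\<close>
    define C where "C = a 0 + (\<Sum>r<k. a r)"
    have C: "a 0 + a r \<le> C" if "r < k" for r
      unfolding C_def using that nonneg by (intro add_left_mono member_le_sum) auto
    have C0: "C \<ge> 0"
      unfolding C_def using nonneg by (intro add_nonneg_nonneg sum_nonneg) auto
    have bound: "a n / real n \<le> a k / real k + C / real n" if "n \<ge> 1" for n
    proof -
      have "a n = a (n div k * k + n mod k)" by simp
      also have "\<dots> \<le> a (n div k * k) + a (n mod k)" by (rule sub)
      also have "\<dots> \<le> real (n div k) * a k + C"
        using mult[of "n div k" k] C[of "n mod k"] k by simp
      also have "real (n div k) * a k \<le> real n / real k * a k"
        using of_nat_div_le_of_nat[of n k, where ?'a = real] nonneg[of k] by (intro mult_right_mono)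
      finally have "a n \<le> real n * (a k / real k) + C" by (simp add: field_simps)
      then have "a n / real n \<le> (real n * (a k / real k) + C) / real n"
        by (rule divide_right_mono) simp
      then show ?thesis using that by (simp add: add_divide_distrib)
    qed
    obtain N where N: "real N > 2 * C / e" using reals_Archimedean2 by blast
    show "\<exists>no. \<forall>n\<ge>no. norm (a n / real n - L) < e"
    proof (intro exI[of _ "max 1 N"] allI impI)
      fix n assume n: "n \<ge> max 1 N"
      then have "2 * C / e < real n" using N by linarith
      then have "C / real n < e / 2" using e n by (simp add: field_simps)
      moreover have "a n / real n \<le> a k / real k + C / real n" "L \<le> a n / real n"
        using bound lower n by auto
      ultimately show "norm (a n / real n - L) < e"
        using k(2) unfolding real_norm_def by linarith
    qed
  qed
  then show ?thesis by (rule convergentI)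
qed

text \<open>Shannon entropy in nats. Labellings replace partitions because joins then become pairs,
  and iterated joins become lists of labels.\<close>

definition label_entropy :: "'a measure \<Rightarrow> ('a \<Rightarrow> 'b) \<Rightarrow> real" where
  "label_entropy M c =
     - (\<Sum>v\<in>c ` space M. measure M (c -` {v} \<inter> space M) * ln (measure M (c -` {v} \<inter> space M)))"

context prob_space
begin

lemma simple_function_mem:
  assumes B: "B \<in> events"
  shows "simple_function M (\<lambda>x. x \<in> B)"
proof -
  have "(\<lambda>x. x \<in> B) -` {v} \<inter> space M = (if v then B else space M - B)" for v
    using sets.sets_into_space[OF B] by auto
  then show ?thesis using B by (simp add: simple_function_def)
qed

text \<open>The base \<open>exp 1\<close> turns the logarithm of \<open>information_space\<close>
  into \<open>ln\<close>, which opens access to the chain rule and to the bound on conditional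
  entropy.\<close>

lemma label_entropy_eq_entropy:
  assumes "simple_function M X"
  shows "label_entropy M X = entropy (exp 1) (count_space (X ` space M)) X"
proof -
  interpret information_space M "exp 1" by unfold_locales simp
  show ?thesis
    using entropy_simple_distributed[OF simple_distributedI[OF assms measure_nonneg refl]]
    by (simp add: label_entropy_def log_def vimage_def Int_def conj_commute)
qed

lemma label_entropy_nonneg: "label_entropy M X \<ge> 0"
proof -
  have "measure M (X -` {v} \<inter> space M) * ln (measure M (X -` {v} \<inter> space M)) \<le> 0" for v
    by (cases "measure M (X -` {v} \<inter> space M) = 0")
      (auto intro!: mult_nonneg_nonpos simp: zero_less_measure_iff)
  then show ?thesis
    unfolding label_entropy_def by (simp add: sum_nonpos)
qed

lemma label_entropy_Pair_le:
  assumes "simple_function M X" "simple_function M Y"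
  shows "label_entropy M (\<lambda>x. (X x, Y x)) \<le> label_entropy M X + label_entropy M Y"
proof -
  interpret information_space M "exp 1" by unfold_locales simp
  show ?thesis
    using entropy_chain_rule[OF assms] conditional_entropy_less_eq_entropy[OF assms(2,1)]
      assms simple_function_Pair[OF assms]
    by (simp add: label_entropy_eq_entropy)
qed

lemma label_entropy_inj:
  assumes "simple_function M X" "inj_on f (X ` space M)"
  shows "label_entropy M (\<lambda>x. f (X x)) = label_entropy M X"
proof -
  interpret information_space M "exp 1" by unfold_locales simp
  show ?thesis
    using entropy_of_inj[OF assms] simple_function_compose[OF assms(1), of f] assms(1)
    by (simp add: label_entropy_eq_entropy comp_def)
qed

text \<open>The strict inequality excludes the points whose \<open>X\<close>-label has probability zero.\<close>

definition typical :: "('a \<Rightarrow> 'b) \<Rightarrow> ('a \<Rightarrow> 'c) \<Rightarrow> real \<Rightarrow> 'a set" where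
  "typical X Y t = {x \<in> space M.
     prob (Y -` {Y x} \<inter> X -` {X x} \<inter> space M) > exp (- t) * prob (X -` {X x} \<inter> space M)}"

lemma typical_measurable:
  assumes X: "simple_function M X" and Y: "simple_function M Y"
  shows "typical X Y t \<in> events"
proof -
  have "simple_function M (\<lambda>x. (X x, Y x))" using X Y by (rule simple_function_Pair)
  then have m: "(\<lambda>x. (X x, Y x)) \<in> M \<rightarrow>\<^sub>M count_space UNIV" by (rule measurable_simple_function)
  have "typical X Y t = (\<lambda>x. (X x, Y x)) -` {(u, v).
     prob (Y -` {v} \<inter> X -` {u} \<inter> space M) > exp (- t) * prob (X -` {u} \<inter> space M)} \<inter> space M"
    by (auto simp: typical_def)
  also have "\<dots> \<in> events" using m by (rule measurable_sets) simp
  finally show ?thesis .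
qed

text \<open>Markov's inequality for the conditional information
  \<open>- ln (p (v, u) / q u)\<close>: its mean is the conditional entropy of \<open>Y\<close>
  given \<open>X\<close>, and it is at least \<open>t\<close> on every atypical label pair of
  positive probability.\<close>

lemma prob_not_typical_le:
  assumes X: "simple_function M X" and Y: "simple_function M Y" and "t > 0"
    and H: "label_entropy M (\<lambda>x. (X x, Y x)) - label_entropy M X \<le> d * t"
  shows "prob (space M - typical X Y t) \<le> d"
proof -
  interpret information_space M "exp 1" by unfold_locales simp
  let ?H = "conditional_entropy (exp 1) (count_space (Y ` space M)) (count_space (X ` space M)) Y X"
  \<comment> \<open>The pair has \<open>Y\<close> first to match the argument order of
    \<open>conditional_entropy_eq\<close>.\<close>
  define Z where "Z = (\<lambda>x. (Y x, X x))"
  define p where "p w = prob (Z -` {w} \<inter> space M)" for w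
  define q where "q u = prob (X -` {u} \<inter> space M)" for u
  have Zs: "simple_function M Z" unfolding Z_def using Y X by (rule simple_function_Pair)
  have fin: "finite (Z ` space M)" using Zs by (rule simple_functionD)
  have Zm: "Z -` A \<inter> space M \<in> events" for A
    using measurable_sets[OF measurable_simple_function[OF Zs], of A] by simp
  have pq: "p (v, u) \<le> q u" for u v
    unfolding p_def q_def by (rule finite_measure_mono) (auto simp: Z_def X simple_functionD)
  have p_eq: "p (v, u) = prob (Y -` {v} \<inter> X -` {u} \<inter> space M)" for u v
    unfolding p_def by (rule arg_cong[of _ _ prob]) (auto simp: Z_def)
  have "simple_distributed M X q"
    by (rule simple_distributedI[OF X]) (auto simp: q_def vimage_def Int_def conj_commute)
  moreover have "simple_distributed M (\<lambda>x. (Y x, X x)) p"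
    by (rule simple_distributedI) (use Zs in \<open>auto simp: p_def Z_def vimage_def Int_def conj_commute\<close>)
  ultimately have "?H = - (\<Sum>(v, u)\<in>Z ` space M. p (v, u) * log (exp 1) (p (v, u) / q u))"
    unfolding Z_def by (rule conditional_entropy_eq)
  then have cond: "?H = (\<Sum>(v, u)\<in>Z ` space M. p (v, u) * - ln (p (v, u) / q u))"
    by (simp add: log_def sum_negf split_def)
  define bad where "bad = {(v, u). (v, u) \<in> Z ` space M \<and> p (v, u) \<le> exp (- t) * q u}"
  have bad: "bad \<subseteq> Z ` space M" by (auto simp: bad_def)
  have "space M - typical X Y t = (\<Union>w\<in>bad. Z -` {w} \<inter> space M)"
    by (auto simp: typical_def bad_def Z_def p_eq q_def not_less)
  also have "prob \<dots> = (\<Sum>w\<in>bad. p w)"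
    unfolding p_def using finite_subset[OF bad fin] Zm
    by (intro finite_measure_finite_Union) (auto simp: disjoint_family_on_def)
  finally have "t * prob (space M - typical X Y t) = (\<Sum>w\<in>bad. t * p w)"
    by (simp add: sum_distrib_left)
  also have "\<dots> \<le> (\<Sum>(v, u)\<in>bad. p (v, u) * - ln (p (v, u) / q u))"
  proof (rule sum_mono, clarify)
    fix v u assume "(v, u) \<in> bad"
    then have le: "p (v, u) \<le> exp (- t) * q u" by (simp add: bad_def)
    show "t * p (v, u) \<le> p (v, u) * - ln (p (v, u) / q u)"
    proof (cases "p (v, u) = 0")
      case False
      then have pos: "p (v, u) > 0" by (simp add: p_def zero_less_measure_iff)
      with pq[of v u] have qpos: "q u > 0" by linarith
      with le have "p (v, u) / q u \<le> exp (- t)" by (simp add: field_simps)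
      then have "ln (p (v, u) / q u) \<le> ln (exp (- t))"
        using pos qpos by (subst ln_le_cancel_iff) auto
      then have "t \<le> - ln (p (v, u) / q u)" by simp
      then show ?thesis using pos by (subst mult.commute) (rule mult_left_mono, auto)
    qed simp
  qed
  also have "\<dots> \<le> (\<Sum>(v, u)\<in>Z ` space M. p (v, u) * - ln (p (v, u) / q u))"
  proof (rule sum_mono2[OF fin bad], clarify)
    fix v u
    show "0 \<le> p (v, u) * - ln (p (v, u) / q u)"
    proof (cases "p (v, u) = 0")
      case False
      then have pos: "p (v, u) > 0" by (simp add: p_def zero_less_measure_iff)
      with pq[of v u] have "p (v, u) / q u \<le> 1" "p (v, u) / q u > 0" by (auto simp: field_simps)
      then show ?thesis using pos by (intro mult_nonneg_nonneg) auto
    qed simp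
  qed
  also have "\<dots> = ?H" by (simp add: cond)
  also have "\<dots> = label_entropy M (\<lambda>x. (X x, Y x)) - label_entropy M X"
    using entropy_chain_rule[OF X Y] X simple_function_Pair[OF X Y]
    by (simp add: label_entropy_eq_entropy)
  also have "\<dots> \<le> t * d" using H by (simp add: mult.commute)
  finally show ?thesis using \<open>t > 0\<close> by simp
qed

text \<open>Within the fibre over \<open>u\<close>, each typical \<open>Y\<close>-label carries more
  than the fraction \<open>exp (- t)\<close> of the mass, and these disjoint pieces cannot exceed
  the whole fibre.\<close>

lemma card_typical_le:
  assumes X: "simple_function M X" and Y: "simple_function M Y"
  shows "finite (Y ` (typical X Y t \<inter> X -` {u}))"
    and "real (card (Y ` (typical X Y t \<inter> X -` {u}))) \<le> exp t"
proof -
  define Q where "Q = Y ` (typical X Y t \<inter> X -` {u})"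
  define q where "q = prob (X -` {u} \<inter> space M)"
  have "finite (Y ` space M)" using Y by (rule simple_functionD)
  then show fin: "finite (Y ` (typical X Y t \<inter> X -` {u}))"
    by (rule rev_finite_subset) (auto simp: typical_def)
  have ev: "Y -` {v} \<inter> X -` {u} \<inter> space M \<in> events" for v
  proof -
    have "Y -` {v} \<inter> X -` {u} \<inter> space M = (Y -` {v} \<inter> space M) \<inter> (X -` {u} \<inter> space M)" by auto
    then show ?thesis using X Y by (simp add: simple_functionD sets.Int)
  qed
  have Q: "prob (Y -` {v} \<inter> X -` {u} \<inter> space M) > exp (- t) * q" if "v \<in> Q" for v
    using that by (auto simp: Q_def typical_def q_def)
  have "real (card Q) * (exp (- t) * q) = (\<Sum>v\<in>Q. exp (- t) * q)" by simp
  also have "\<dots> \<le> (\<Sum>v\<in>Q. prob (Y -` {v} \<inter> X -` {u} \<inter> space M))"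
    using Q by (intro sum_mono) (auto intro: less_imp_le)
  also have "\<dots> = prob (\<Union>v\<in>Q. Y -` {v} \<inter> X -` {u} \<inter> space M)"
    using fin ev by (intro finite_measure_finite_Union[symmetric]) (auto simp: Q_def disjoint_family_on_def)
  also have "\<dots> \<le> q"
    unfolding q_def using X by (intro finite_measure_mono) (auto simp: simple_functionD)
  finally have le: "real (card Q) * exp (- t) * q \<le> q" by (simp add: mult.assoc)
  show "real (card (Y ` (typical X Y t \<inter> X -` {u}))) \<le> exp t"
  proof (cases "Q = {}")
    case False
    then obtain v where "v \<in> Q" by auto
    have "prob (Y -` {v} \<inter> X -` {u} \<inter> space M) \<le> q"
      unfolding q_def using X by (intro finite_measure_mono) (auto simp: simple_functionD)
    \<comment> \<open>Here strictness in \<open>typical\<close> pays off: it forces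
      \<open>q > 0\<close>, so that \<open>q\<close> can be cancelled.\<close>
    then have "exp (- t) * q < q" using Q[OF \<open>v \<in> Q\<close>] by linarith
    then have "q \<noteq> 0" by auto
    then have "q > 0" by (simp add: q_def zero_less_measure_iff)
    with le have "real (card Q) * exp (- t) \<le> 1" by simp
    then show ?thesis by (simp add: Q_def exp_minus field_simps)
  qed (simp add: Q_def)
qed

end

section \<open>Names of orbits and the entropy of the system\<close>

context ergodic_system
begin

lemma funpow_bij: "bij_betw (T ^^ n) (space M) (space M)"
  by (rule bij_betw_funpow[OF T_bij])

lemma funpow_space: "x \<in> space M \<Longrightarrow> (T ^^ n) x \<in> space M"
  using funpow_bij[of n] by (auto simp: bij_betw_def)

lemma funpow_measurable [measurable]: "T ^^ n \<in> M \<rightarrow>\<^sub>M M"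
proof (induction n)
  case (Suc n)
  then show ?case
    unfolding funpow.simps using T_measurable by (rule measurable_comp)
qed (simp add: id_def)

lemma prob_funpow_vimage:
  assumes "A \<in> events"
  shows "prob ((T ^^ n) -` A \<inter> space M) = prob A"
proof (induction n)
  case (Suc n)
  have "(T ^^ Suc n) -` A \<inter> space M = T -` ((T ^^ n) -` A \<inter> space M) \<inter> space M"
    using funpow_space[of _ 1] by (auto simp: funpow_swap1)
  moreover have "(T ^^ n) -` A \<inter> space M \<in> events"
    using assms by (rule measurable_sets[OF funpow_measurable])
  ultimately have "prob ((T ^^ Suc n) -` A \<inter> space M) = prob ((T ^^ n) -` A \<inter> space M)"
    using T_preserves by (simp only: measure_def)
  with Suc show ?case by (simp only:)
qed (use assms sets.sets_into_space in \<open>simp add: Int_absorb2\<close>)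

definition name :: "('a \<Rightarrow> 'b) \<Rightarrow> nat \<Rightarrow> 'a \<Rightarrow> 'b list" where
  "name c n x = map (\<lambda>i. c ((T ^^ i) x)) [0..<n]"

lemma name_0: "name c 0 = (\<lambda>x. [])"
  by (simp add: name_def fun_eq_iff)

lemma name_add: "name c (m + n) x = name c m x @ name c n ((T ^^ m) x)"
proof -
  have "c ((T ^^ i) ((T ^^ m) x)) = c ((T ^^ (m + i)) x)" for i
    by (simp add: funpow_add add.commute)
  then show ?thesis
    unfolding name_def by (intro nth_equalityI) (auto simp: nth_append)
qed

lemma simple_function_funpow:
  "simple_function M c \<Longrightarrow> simple_function M (\<lambda>x. c ((T ^^ n) x))"
  by (rule simple_function_comp[OF funpow_measurable])

lemma simple_function_name:
  assumes "simple_function M c"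
  shows "simple_function M (name c n)"
proof (induction n)
  case (Suc n)
  have "name c (Suc n) = (\<lambda>(w, v). w @ [v]) \<circ> (\<lambda>x. (name c n x, c ((T ^^ n) x)))"
    by (auto simp: name_def)
  then show ?case
    using simple_function_compose[OF simple_function_Pair[OF Suc simple_function_funpow[OF assms, of n]]]
    by (simp only:)
qed (simp add: name_0)

lemma label_entropy_funpow:
  assumes "simple_function M c"
  shows "label_entropy M (\<lambda>x. c ((T ^^ m) x)) = label_entropy M c"
proof -
  have im: "(\<lambda>x. c ((T ^^ m) x)) ` space M = c ` space M"
    using funpow_bij[of m] unfolding bij_betw_def by (simp add: image_image[symmetric])
  have "(\<lambda>x. c ((T ^^ m) x)) -` {v} \<inter> space M = (T ^^ m) -` (c -` {v} \<inter> space M) \<inter> space M" for v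
    using funpow_space by auto
  then have "prob ((\<lambda>x. c ((T ^^ m) x)) -` {v} \<inter> space M) = prob (c -` {v} \<inter> space M)" for v
    using prob_funpow_vimage[of "c -` {v} \<inter> space M" m] assms by (simp add: simple_functionD)
  then show ?thesis unfolding label_entropy_def im by simp
qed

text \<open>A name of length \<open>m + n\<close> is a name of length \<open>m\<close> followed by
  one of length \<open>n\<close> read at a shifted point, and the shift preserves entropy; so the
  sequence is subadditive.\<close>

lemma convergent_name_entropy:
  assumes c: "simple_function M c"
  shows "convergent (\<lambda>n. label_entropy M (name c n) / real n)"
proof (rule fekete)
  fix m n
  have s: "simple_function M (name c m)" "simple_function M (\<lambda>x. name c n ((T ^^ m) x))"
    using simple_function_name[OF c] simple_function_funpow by auto
  have "label_entropy M (name c (m + n))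
      = label_entropy M (\<lambda>x. (\<lambda>(u, v). u @ v) (name c m x, name c n ((T ^^ m) x)))"
    by (simp add: name_add[abs_def])
  also have "\<dots> = label_entropy M (\<lambda>x. (name c m x, name c n ((T ^^ m) x)))"
    by (rule label_entropy_inj[OF simple_function_Pair[OF s]]) (auto simp: inj_on_def name_def)
  also have "\<dots> \<le> label_entropy M (name c m) + label_entropy M (\<lambda>x. name c n ((T ^^ m) x))"
    using s by (rule label_entropy_Pair_le)
  also have "label_entropy M (\<lambda>x. name c n ((T ^^ m) x)) = label_entropy M (name c n)"
    by (rule label_entropy_funpow[OF simple_function_name[OF c]])
  finally show "label_entropy M (name c (m + n)) \<le> label_entropy M (name c m) + label_entropy M (name c n)" .
qed (rule label_entropy_nonneg)

definition fibres :: "('a \<Rightarrow> 'b) \<Rightarrow> 'a set set" where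
  "fibres c = (\<lambda>v. c -` {v} \<inter> space M) ` (c ` space M)"

lemma partition_entropy_fibres: "partition_entropy M (fibres c) = label_entropy M c"
proof -
  have "inj_on (\<lambda>v. c -` {v} \<inter> space M) (c ` space M)"
    by (auto simp: inj_on_def)
  then show ?thesis
    by (simp add: partition_entropy_def label_entropy_def fibres_def sum.reindex)
qed

lemma partition_on_fibres: "partition_on (space M) (fibres c)"
  by (auto simp: partition_on_def fibres_def disjoint_def)

text \<open>A nonempty cell of the refinement is determined by any of its points \<open>x\<close>,
  as the intersection of the cells containing \<open>x\<close>. Positivity of \<open>n\<close>
  matters: an empty intersection is \<open>UNIV\<close>, not \<open>space M\<close>.\<close>

lemma iterated_join_fibres:
  assumes "n > 0"
  shows "iterated_join M T (fibres c) n = fibres (name c n)"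
proof -
  define R where "R i = (\<lambda>A. (T ^^ i) -` A \<inter> space M) ` fibres c" for i
  \<comment> \<open>\<open>common_refinement\<close> chooses one cell per partition, not per index,
    and \<open>R\<close> need not be injective. Hence the chosen cell is expressed through the
    partition itself, as the union of its cells containing \<open>x\<close>.\<close>
  define f where "f x = (\<lambda>P. {y \<in> space M. \<exists>A\<in>P. x \<in> A \<and> y \<in> A})" for x
  have cell: "A = {y \<in> space M. c ((T ^^ i) y) = c ((T ^^ i) x)}" if "A \<in> R i" "x \<in> A" for A i x
    using that funpow_space by (auto simp: R_def fibres_def)
  have cell': "{y \<in> space M. c ((T ^^ i) y) = c ((T ^^ i) x)} \<in> R i" if "x \<in> space M" for i x
  proof -
    have "{y \<in> space M. c ((T ^^ i) y) = c ((T ^^ i) x)}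
        = (T ^^ i) -` (c -` {c ((T ^^ i) x)} \<inter> space M) \<inter> space M"
      using funpow_space by auto
    moreover have "c ((T ^^ i) x) \<in> c ` space M"
      using funpow_space[OF that] by simp
    ultimately show ?thesis
      unfolding R_def fibres_def by blast
  qed
  have fib: "name c n -` {name c n x} \<inter> space M
      = (\<Inter>i<n. {y \<in> space M. c ((T ^^ i) y) = c ((T ^^ i) x)})" for x
    using assms by (auto simp: name_def)
  have fR: "f x (R i) = {y \<in> space M. c ((T ^^ i) y) = c ((T ^^ i) x)}" if "x \<in> space M" for x i
    unfolding f_def using cell[of _ i x] cell'[OF that, of i] that by blast
  show ?thesis
    unfolding iterated_join_def common_refinement R_def[symmetric]
  proof (intro equalityI subsetI)
    fix A assume "A \<in> (\<Union>g\<in>(\<Pi> P\<in>R ` {..<n}. P). {\<Inter> (g ` R ` {..<n})}) - {{}}"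
    then obtain g where g: "\<And>i. i < n \<Longrightarrow> g (R i) \<in> R i" "A = (\<Inter>i<n. g (R i))" "A \<noteq> {}"
      by (auto simp: image_image)
    then obtain x where x: "x \<in> A" by auto
    have gc: "g (R i) = {y \<in> space M. c ((T ^^ i) y) = c ((T ^^ i) x)}" if "i < n" for i
      using cell[OF g(1)[OF that]] x that g(2) by blast
    then have "A = name c n -` {name c n x} \<inter> space M"
      unfolding fib g(2) by auto
    moreover have "x \<in> space M" using gc[OF assms] x g(2) assms by blast
    ultimately show "A \<in> fibres (name c n)" by (auto simp: fibres_def)
  next
    fix A assume "A \<in> fibres (name c n)"
    then obtain x where x: "x \<in> space M" "A = name c n -` {name c n x} \<inter> space M"
      by (auto simp: fibres_def)
    have "A = \<Inter> (f x ` R ` {..<n})"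
      unfolding x(2) fib image_image using fR[OF x(1)] by simp
    moreover have "f x \<in> (\<Pi> P\<in>R ` {..<n}. P)"
      using fR[OF x(1)] cell'[OF x(1)] by auto
    moreover have "A \<noteq> {}" using x by auto
    ultimately show "A \<in> (\<Union>g\<in>(\<Pi> P\<in>R ` {..<n}. P). {\<Inter> (g ` R ` {..<n})}) - {{}}"
      by blast
  qed
qed

lemma entropy_wrt_fibres:
  assumes "simple_function M c"
  shows "(\<lambda>n. label_entropy M (name c n) / real n) \<longlonglongrightarrow> entropy_wrt_partition M T (fibres c)"
proof -
  obtain h where h: "(\<lambda>n. label_entropy M (name c n) / real n) \<longlonglongrightarrow> h"
    using convergent_name_entropy[OF assms] by (auto simp: convergent_def)
  have "(\<lambda>n. partition_entropy M (iterated_join M T (fibres c) n) / real n) \<longlonglongrightarrow> h"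
  proof (rule Lim_transform_eventually[OF h])
    show "\<forall>\<^sub>F n in sequentially. label_entropy M (name c n) / real n
        = partition_entropy M (iterated_join M T (fibres c) n) / real n"
      using eventually_gt_at_top[of 0]
      by eventually_elim (simp add: iterated_join_fibres partition_entropy_fibres)
  qed
  then show ?thesis
    using h by (simp add: entropy_wrt_partition_def limI)
qed

text \<open>Each point is labelled by the cell that contains it.\<close>

lemma measurable_partitionE:
  assumes N: "subalgebra M N" and P: "P \<in> measurable_partitions N"
  obtains c :: "'a \<Rightarrow> 'a set"
  where "simple_function M c" "\<And>v. c -` {v} \<inter> space M \<in> sets N" "P = fibres c"
proof -
  from P N have P: "finite P" "P \<subseteq> sets N" "partition_on (space M) P"
    and N: "sets N \<subseteq> sets M" "space N = space M"
    by (auto simp: measurable_partitions_def subalgebra_def)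
  define c where "c x = (THE C. C \<in> P \<and> x \<in> C)" for x
  have c_eq: "c x = C" if "C \<in> P" "x \<in> C" for x C
    unfolding c_def using that P(3) by (intro the_equality) (auto simp: partition_on_def disjoint_def)
  have cP: "c x \<in> P \<and> x \<in> c x" if "x \<in> space M" for x
  proof -
    from that P(3) obtain C where "C \<in> P" "x \<in> C" by (auto simp: partition_on_def)
    with c_eq show ?thesis by simp
  qed
  have sub: "C \<subseteq> space M" if "C \<in> P" for C
    using P(3) that by (auto simp: partition_on_def)
  have fib: "c -` {C} \<inter> space M = C" if "C \<in> P" for C
    using c_eq[OF that] cP sub[OF that] by auto
  have im: "c ` space M = P"
  proof
    show "P \<subseteq> c ` space M"
    proof
      fix C assume C: "C \<in> P"
      with P(3) obtain x where "x \<in> C" by (metis partition_on_def ex_in_conv)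
      with C c_eq sub show "C \<in> c ` space M" by blast
    qed
  qed (use cP in auto)
  have fibN: "c -` {v} \<inter> space M \<in> sets N" for v
  proof (cases "v \<in> P")
    case False
    then have "c -` {v} \<inter> space M = {}" using im by auto
    then show ?thesis by simp
  qed (use fib P(2) in auto)
  show thesis
  proof (rule that[of c])
    show "simple_function M c"
      unfolding simple_function_def using fibN N P(1) im by auto
    show "P = fibres c" unfolding fibres_def im using fib by simp
  qed (rule fibN)
qed

lemma fibres_measurable_partition:
  "simple_function M c \<Longrightarrow> fibres c \<in> measurable_partitions M"
  using partition_on_fibres
  by (auto simp: measurable_partitions_def fibres_def simple_functionD)

text \<open>Full entropy gives a partition of the factor whose entropy is within
  \<open>e / 2\<close> of the supremum. Joining \<open>B\<close> to it cannot exceed the supremum,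
  so the two limiting rates differ by less than \<open>e\<close>, and the inequality passes to large
  \<open>n\<close>.\<close>

lemma full_entropy_conditional_names:
  assumes N: "subalgebra M N" and full: "full_entropy M T N" and fin: "system_entropy M T < \<infinity>"
    and B: "B \<in> events" and e: "e > 0"
  obtains c :: "'a \<Rightarrow> 'a set"
  where "simple_function M c" "\<And>v. c -` {v} \<inter> space M \<in> sets N"
    "\<forall>\<^sub>F n in sequentially. label_entropy M (\<lambda>x. (name c n x, name (\<lambda>x. x \<in> B) n x))
       - label_entropy M (name c n) \<le> e * real n"
proof -
  have le: "ereal (entropy_wrt_partition M T P) \<le> system_entropy M T"
    if "P \<in> measurable_partitions M" for P
    unfolding system_entropy_def factor_entropy_def using that by (rule SUP_upper)
  \<comment> \<open>The one-cell partition keeps the supremum away from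
    \<open>- \<infinity>\<close>, so that it is a real number.\<close>
  have triv: "fibres (\<lambda>x. ()) \<in> measurable_partitions M"
    by (rule fibres_measurable_partition) simp
  have "system_entropy M T \<noteq> - \<infinity>"
    using le[OF triv] by auto
  with fin obtain s where s: "system_entropy M T = ereal s"
    by (cases "system_entropy M T") auto
  have "ereal (s - e / 2) < factor_entropy M T N"
    using full e s by (simp add: full_entropy_def)
  then obtain P where P: "P \<in> measurable_partitions N" "s - e / 2 < entropy_wrt_partition M T P"
    unfolding factor_entropy_def by (auto simp: less_SUP_iff)
  from N P(1) obtain c :: "'a \<Rightarrow> 'a set" where c: "simple_function M c"
    "\<And>v. c -` {v} \<inter> space M \<in> sets N" "P = fibres c"
    by (rule measurable_partitionE) blast
  have bs: "simple_function M (\<lambda>x. x \<in> B)" using B by (rule simple_function_mem)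
  define d where "d x = (c x, x \<in> B)" for x
  have d: "simple_function M d" unfolding d_def using c(1) bs by (rule simple_function_Pair)
  have "entropy_wrt_partition M T (fibres d) \<le> s"
    using le[OF fibres_measurable_partition[OF d]] s by simp
  then have "entropy_wrt_partition M T (fibres d) - entropy_wrt_partition M T (fibres c) < e"
    using P(2)[unfolded c(3)] e by linarith
  moreover have "(\<lambda>n. label_entropy M (name d n) / real n - label_entropy M (name c n) / real n)
      \<longlonglongrightarrow> entropy_wrt_partition M T (fibres d) - entropy_wrt_partition M T (fibres c)"
    using entropy_wrt_fibres[OF d] entropy_wrt_fibres[OF c(1)] by (rule tendsto_diff)
  ultimately have ev: "\<forall>\<^sub>F n in sequentially.
      label_entropy M (name d n) / real n - label_entropy M (name c n) / real n < e"
    by (intro order_tendstoD(2))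
  have eq: "label_entropy M (\<lambda>x. (name c n x, name (\<lambda>x. x \<in> B) n x)) = label_entropy M (name d n)" for n
  proof -
    have "label_entropy M (\<lambda>x. (name c n x, name (\<lambda>x. x \<in> B) n x))
        = label_entropy M (\<lambda>x. (\<lambda>w. (map fst w, map snd w)) (name d n x))"
      by (simp add: name_def d_def comp_def)
    also have "\<dots> = label_entropy M (name d n)"
      by (rule label_entropy_inj[OF simple_function_name[OF d]])
        (auto simp: inj_on_def intro: pair_list_eqI)
    finally show ?thesis .
  qed
  show thesis
  proof (rule that[OF c(1,2)])
    show "\<forall>\<^sub>F n in sequentially. label_entropy M (\<lambda>x. (name c n x, name (\<lambda>x. x \<in> B) n x))
       - label_entropy M (name c n) \<le> e * real n"
      using ev eventually_gt_at_top[of 0]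
      unfolding eq by eventually_elim (simp add: field_simps)
  qed
qed


section \<open>Images under the transformation and recurrence\<close>

lemma funpow_vimage_image:
  "A \<subseteq> space M \<Longrightarrow> (T ^^ n) -` ((T ^^ n) ` A) \<inter> space M = A"
  using funpow_bij[of n] by (auto simp: bij_betw_def inj_on_def)

lemma funpow_image_vimage:
  assumes "A \<subseteq> space M"
  shows "(T ^^ n) ` ((T ^^ n) -` A \<inter> space M) = A"
proof -
  have "(T ^^ n) ` space M = space M" using funpow_bij[of n] by (simp add: bij_betw_def)
  with assms have "A \<subseteq> (T ^^ n) ` space M" by simp
  then show ?thesis by blast
qed

lemma funpow_image_Diff:
  "A \<subseteq> space M \<Longrightarrow> B \<subseteq> space M \<Longrightarrow> (T ^^ n) ` (A - B) = (T ^^ n) ` A - (T ^^ n) ` B"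
  using funpow_bij[of n] by (intro inj_on_image_set_diff[of _ "space M"]) (auto simp: bij_betw_def)

lemma image_events:
  assumes "A \<in> events"
  shows "T ` A \<in> events"
proof -
  have A: "A \<subseteq> space M" using assms by (rule sets.sets_into_space)
  have inj: "inj_on T (space M)" and im: "T ` space M = space M"
    using T_bij by (auto simp: bij_betw_def)
  have "T ` A = the_inv_into (space M) T -` A \<inter> space M"
  proof (intro equalityI subsetI)
    fix y assume "y \<in> T ` A"
    then show "y \<in> the_inv_into (space M) T -` A \<inter> space M"
      using A im the_inv_into_f_f[OF inj] by auto
  next
    fix y assume y: "y \<in> the_inv_into (space M) T -` A \<inter> space M"
    then have "T (the_inv_into (space M) T y) = y"
      using f_the_inv_into_f[OF inj] im by simp
    with y show "y \<in> T ` A" by force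
  qed
  with measurable_sets[OF T_inv_measurable assms] show ?thesis by simp
qed

lemma funpow_image_events: "A \<in> events \<Longrightarrow> (T ^^ n) ` A \<in> events"
proof (induction n)
  case (Suc n)
  have "(T ^^ Suc n) ` A = T ` ((T ^^ n) ` A)" by auto
  with Suc image_events show ?case by simp
qed simp

lemma prob_funpow_image:
  assumes "A \<in> events"
  shows "prob ((T ^^ n) ` A) = prob A"
  using prob_funpow_vimage[OF funpow_image_events[OF assms], of n n] funpow_vimage_image
    sets.sets_into_space[OF assms] by simp

lemma int_preimage_events: "A \<in> events \<Longrightarrow> int_preimage M T n A \<in> events"
  by (auto simp: int_preimage_def intro: measurable_sets[OF funpow_measurable] funpow_image_events)

lemma prob_int_preimage: "A \<in> events \<Longrightarrow> prob (int_preimage M T n A) = prob A"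
  by (simp add: int_preimage_def prob_funpow_vimage prob_funpow_image)

lemma int_preimage_sym_diff:
  assumes "A \<subseteq> space M" "B \<subseteq> space M"
  shows "sym_diff (int_preimage M T n A) (int_preimage M T n B) = int_preimage M T n (sym_diff A B)"
  using assms by (auto simp: int_preimage_def image_Un funpow_image_Diff)

text \<open>For \<open>n > 0\<close> one preimage is undone, otherwise one more image is taken; the
  case split follows the two branches of \<open>int_preimage\<close>, with \<open>n = 0\<close>
  treated as a zeroth image.\<close>

lemma image_int_preimage:
  assumes "A \<subseteq> space M"
  shows "T ` int_preimage M T n A = int_preimage M T (n - 1) A"
proof (cases "n > 0")
  case True
  then obtain k where k: "n = int (Suc k)" by (metis gr0_implies_Suc zero_less_imp_eq_int)
  have "int_preimage M T n A = T -` ((T ^^ k) -` A \<inter> space M) \<inter> space M"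
    using funpow_space[of _ 1] unfolding int_preimage_def k
    by (auto simp: funpow_swap1 nat_add_distrib)
  then have "T ` int_preimage M T n A = (T ^^ k) -` A \<inter> space M"
    using funpow_image_vimage[of "(T ^^ k) -` A \<inter> space M" 1] by simp
  then show ?thesis unfolding int_preimage_def k by simp
next
  case False
  then obtain k where k: "n = - int k" by (metis int_cases2 of_nat_0_less_iff neq0_conv of_nat_0 minus_zero)
  have "int_preimage M T n A = (T ^^ k) ` A"
    using assms by (cases "k = 0") (auto simp: int_preimage_def k)
  moreover have "int_preimage M T (n - 1) A = (T ^^ Suc k) ` A"
  proof -
    have "nat (- (n - 1)) = Suc k" using k by simp
    moreover have "\<not> n - 1 \<ge> 0" using k by simp
    ultimately show ?thesis by (simp only: int_preimage_def if_False)
  qed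
  ultimately show ?thesis by (auto simp: image_image)
qed

text \<open>\<open>T_ergodic\<close> speaks of strictly invariant sets, whereas the preimage of
  \<open>U 0\<close> is only contained in \<open>U 0\<close>. The set \<open>W\<close> of points
  that visit \<open>E\<close> infinitely often is strictly invariant. It has the measure of
  \<open>U 0\<close>, because the decreasing sets \<open>U k\<close> are iterated preimages of one
  another.\<close>

lemma prob_eventually_hits:
  assumes E: "E \<in> events" and pos: "prob E > 0"
  shows "prob {x \<in> space M. \<exists>s. (T ^^ s) x \<in> E} = 1"
proof -
  define U where "U k = {x \<in> space M. \<exists>s\<ge>k. (T ^^ s) x \<in> E}" for k
  have U: "U k \<in> events" for k
  proof -
    have "U k = (\<Union>s\<in>{k..}. (T ^^ s) -` E \<inter> space M)"
      by (auto simp: U_def)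
    also have "\<dots> \<in> events"
      by (intro sets.countable_UN'' measurable_sets[OF funpow_measurable E]) auto
    finally show ?thesis .
  qed
  have USuc: "U (Suc k) = T -` U k \<inter> space M" for k
  proof (intro equalityI subsetI)
    fix x assume "x \<in> U (Suc k)"
    then obtain s where s: "s \<ge> Suc k" "(T ^^ s) x \<in> E" "x \<in> space M" by (auto simp: U_def)
    then obtain s' where "s = Suc s'" "s' \<ge> k" by (cases s) auto
    with s show "x \<in> T -` U k \<inter> space M"
      using funpow_space[of x 1] by (auto simp: U_def funpow_swap1)
  next
    fix x assume "x \<in> T -` U k \<inter> space M"
    then obtain s where s: "s \<ge> k" "(T ^^ s) (T x) \<in> E" "x \<in> space M" by (auto simp: U_def)
    then show "x \<in> U (Suc k)"
      unfolding U_def by (auto simp: funpow_swap1 intro!: exI[of _ "Suc s"])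
  qed
  have pU: "prob (U k) = prob (U 0)" for k
  proof (induction k)
    case (Suc k)
    have "prob (U (Suc k)) = prob (U k)"
      using prob_funpow_vimage[OF U, of 1 k] by (simp add: USuc)
    with Suc show ?case by simp
  qed simp
  define W where "W = (\<Inter>k. U k)"
  have anti: "U (Suc k) \<subseteq> U k" for k
    by (auto simp: U_def dest: Suc_leD)
  have W: "W \<in> events" unfolding W_def using U by auto
  have "T -` W \<inter> space M = (\<Inter>k. U (Suc k))"
    unfolding W_def by (auto simp: USuc)
  also have "\<dots> = W"
    unfolding W_def using anti by blast
  finally have "T -` W \<inter> space M = W" .
  then have "prob W = 0 \<or> prob W = 1" using W T_ergodic by blast
  moreover have "prob W = prob (U 0)"
  proof -
    have "(\<lambda>k. prob (U k)) \<longlonglongrightarrow> prob W"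
      unfolding W_def using U anti by (intro finite_Lim_measure_decseq decseq_SucI) auto
    moreover have "(\<lambda>k. prob (U k)) \<longlonglongrightarrow> prob (U 0)"
      by (intro tendsto_eventually always_eventually allI pU)
    ultimately show ?thesis by (rule LIMSEQ_unique)
  qed
  moreover have "prob E \<le> prob (U 0)"
  proof (rule finite_measure_mono[OF _ U])
    show "E \<subseteq> U 0"
    proof
      fix x assume "x \<in> E"
      moreover from this have "x \<in> space M" using sets.sets_into_space[OF E] by blast
      moreover have "(T ^^ 0) x = x" by simp
      ultimately show "x \<in> U 0" unfolding U_def by (metis (mono_tags, lifting) mem_Collect_eq le_refl)
    qed
  qed
  ultimately show ?thesis using pos by (simp add: U_def)
qed

end


section \<open>Factors\<close>

locale factor_system = ergodic_system +
  fixes B0 :: "'a measure"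
  assumes invariant: "invariant_subalgebra M T B0"
begin

lemma B0_events: "sets B0 \<subseteq> events" and space_B0: "space B0 = space M"
  using invariant by (auto simp: invariant_subalgebra_def subalgebra_def)

text \<open>Unlike \<open>sets B0\<close>, its saturation is stable under images and preimages by
  \<open>T\<close> exactly, with no exceptional null sets to carry along.\<close>

definition factor_sets :: "'a set set" where
  "factor_sets = null_closure M (sets B0)"

lemma factor_sets_events: "factor_sets \<subseteq> events"
  unfolding factor_sets_def by (rule null_closure_subset)

lemma B0_factor_sets: "sets B0 \<subseteq> factor_sets"
  unfolding factor_sets_def using B0_events by (rule subset_null_closure)

sublocale factor: sigma_algebra "space M" factor_sets
  unfolding factor_sets_def
  using sets.sigma_algebra_axioms[of B0] B0_events by (intro sigma_algebra_null_closure) (simp add: space_B0)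

lemma null_sets_image:
  assumes "A \<in> null_sets M"
  shows "T ` A \<in> null_sets M"
proof -
  have A: "A \<in> events" using assms by auto
  then have "prob (T ` A) = prob A" using prob_funpow_image[of A 1] by simp
  with A assms show ?thesis by (simp add: null_sets_iff_prob image_events)
qed

lemma null_sets_vimage:
  assumes "A \<in> null_sets M"
  shows "T -` A \<inter> space M \<in> null_sets M"
  using assms T_preserves measurable_sets[OF T_measurable]
  by (auto simp: null_sets_def)

lemma image_sym_diff:
  "A \<subseteq> space M \<Longrightarrow> B \<subseteq> space M \<Longrightarrow> sym_diff (T ` A) (T ` B) = T ` sym_diff A B"
  using funpow_image_Diff[of A B 1] funpow_image_Diff[of B A 1] by (simp add: image_Un)

lemma factor_sets_vimage:
  assumes "A \<in> factor_sets"
  shows "T -` A \<inter> space M \<in> factor_sets"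
proof -
  from assms obtain C where C: "A \<in> events" "C \<in> sets B0" "sym_diff A C \<in> null_sets M"
    unfolding factor_sets_def by (rule null_closureE)
  then obtain D where D: "D \<in> sets B0" "sym_diff (T -` C \<inter> space M) D \<in> null_sets M"
    using invariant by (auto simp: invariant_subalgebra_def eq_mod_null_def)
  have "sym_diff (T -` A \<inter> space M) (T -` C \<inter> space M) = T -` sym_diff A C \<inter> space M"
    by auto
  with null_sets_vimage[OF C(3)]
  have "sym_diff (T -` A \<inter> space M) (T -` C \<inter> space M) \<in> null_sets M"
    by (simp only:)
  then have "sym_diff (T -` A \<inter> space M) D \<in> null_sets M"
    using D(2)
    by (rule null_sets_sym_diff_trans) (use D B0_events measurable_sets[OF T_measurable C(1)] in blast)+
  with D(1) C(1) show ?thesis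
    unfolding factor_sets_def using measurable_sets[OF T_measurable] by (intro null_closureI) auto
qed

text \<open>This uses the half of invariance opposite to the one for preimages: every set of
  \<open>B0\<close> is, up to a null set, the preimage of another one.\<close>

lemma factor_sets_image:
  assumes "A \<in> factor_sets"
  shows "T ` A \<in> factor_sets"
proof -
  from assms obtain C where C: "A \<in> events" "C \<in> sets B0" "sym_diff A C \<in> null_sets M"
    unfolding factor_sets_def by (rule null_closureE)
  then obtain D where D: "D \<in> sets B0" "sym_diff (T -` D \<inter> space M) C \<in> null_sets M"
    using invariant by (auto simp: invariant_subalgebra_def eq_mod_null_def)
  have CD: "C \<in> events" "D \<in> events" using C D B0_events by auto
  have V: "T -` D \<inter> space M \<in> events" by (rule measurable_sets[OF T_measurable CD(2)])
  have "sym_diff C (T -` D \<inter> space M) \<in> null_sets M"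
    using D(2) by (simp only: Un_commute)
  then have "sym_diff A (T -` D \<inter> space M) \<in> null_sets M"
    using C(1) V by (rule null_sets_sym_diff_trans[OF C(3)])
  then have "T ` sym_diff A (T -` D \<inter> space M) \<in> null_sets M"
    by (rule null_sets_image)
  then have "sym_diff (T ` A) (T ` (T -` D \<inter> space M)) \<in> null_sets M"
    by (simp only: image_sym_diff[OF sets.sets_into_space[OF C(1)] sets.sets_into_space[OF V]])
  moreover have "T ` (T -` D \<inter> space M) = D"
    using funpow_image_vimage[of D 1] sets.sets_into_space[OF CD(2)] by simp
  ultimately show ?thesis
    unfolding factor_sets_def using C(1) D(1) image_events by (intro null_closureI) auto
qed

lemma factor_sets_funpow_vimage:
  assumes "A \<in> factor_sets"
  shows "(T ^^ n) -` A \<inter> space M \<in> factor_sets"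
proof (induction n)
  case 0
  then show ?case using assms factor.sets_into_space[OF assms] by (simp add: Int_absorb2)
next
  case (Suc n)
  have "(T ^^ Suc n) -` A \<inter> space M = T -` ((T ^^ n) -` A \<inter> space M) \<inter> space M"
    using funpow_space[of _ 1] by (auto simp: funpow_swap1)
  with factor_sets_vimage[OF Suc] show ?case by (simp only:)
qed

text \<open>Only the translates of \<open>A\<close> are adjoined: those of its complement are their
  complements, as \<open>T\<close> is a bijection of the space.\<close>

definition relative_sets :: "'a set \<Rightarrow> 'a set set" where
  "relative_sets A =
     null_closure M (sigma_sets (space M) (sets B0 \<union> range (\<lambda>n. int_preimage M T n A)))"

context
  fixes A
  assumes A: "A \<in> events"
begin

lemma relative_generators_events: "sets B0 \<union> range (\<lambda>n. int_preimage M T n A) \<subseteq> events"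
  using B0_events int_preimage_events[OF A] by auto

lemma relative_sigma_sets_events:
  "sigma_sets (space M) (sets B0 \<union> range (\<lambda>n. int_preimage M T n A)) \<subseteq> events"
  using relative_generators_events by (rule sets.sigma_sets_subset)

lemma relative_sigma_algebra:
  "sigma_algebra (space M) (sigma_sets (space M) (sets B0 \<union> range (\<lambda>n. int_preimage M T n A)))"
  using relative_generators_events sets.space_closed[of M] by (intro sigma_algebra_sigma_sets) (rule subset_trans)

lemma sigma_algebra_relative_sets: "sigma_algebra (space M) (relative_sets A)"
  unfolding relative_sets_def
  using relative_sigma_algebra relative_sigma_sets_events by (rule sigma_algebra_null_closure)

lemma relative_sets_events: "relative_sets A \<subseteq> events"
  unfolding relative_sets_def by (rule null_closure_subset)

lemma int_preimage_relative_sets: "int_preimage M T n A \<in> relative_sets A"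
  unfolding relative_sets_def
  using subset_null_closure[OF relative_sigma_sets_events] by blast

lemma factor_sets_relative_sets: "factor_sets \<subseteq> relative_sets A"
  unfolding relative_sets_def factor_sets_def by (intro null_closure_mono) auto

text \<open>Decoding yields sets in the base of a tower; this is what moves them up to the other
  levels. On generators, \<open>T\<close> only shifts the exponent of a translate of
  \<open>A\<close> and preserves the saturated factor.\<close>

lemma relative_sets_image:
  assumes "D \<in> relative_sets A"
  shows "T ` D \<in> relative_sets A"
proof -
  interpret R: sigma_algebra "space M" "relative_sets A" by (rule sigma_algebra_relative_sets)
  from assms obtain C where C: "D \<in> events" "sym_diff D C \<in> null_sets M"
    "C \<in> sigma_sets (space M) (sets B0 \<union> range (\<lambda>n. int_preimage M T n A))"
    unfolding relative_sets_def by (rule null_closureE) blast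
  from C(3) have TC: "T ` C \<in> relative_sets A"
  proof (induction rule: sigma_sets.induct)
    case (Basic a)
    then show ?case
      using factor_sets_image B0_factor_sets factor_sets_relative_sets int_preimage_relative_sets
        image_int_preimage[OF sets.sets_into_space[OF A]] by auto
  next
    case (Compl a)
    have "a \<subseteq> space M"
      using Compl.hyps relative_sigma_sets_events sets.sets_into_space by blast
    then have "T ` (space M - a) = space M - T ` a"
      using funpow_image_Diff[of "space M" a 1] T_bij by (simp add: bij_betw_def)
    then show ?case using Compl.IH by auto
  next
    case (Union a)
    then show ?case by (auto simp: image_UN)
  qed simp
  have CM: "C \<in> events" using C(3) relative_sigma_sets_events by blast
  have "sym_diff (T ` D) (T ` C) \<in> null_sets M"
    using null_sets_image[OF C(2)] image_sym_diff sets.sets_into_space[OF C(1)] sets.sets_into_space[OF CM]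
    by simp
  then show ?thesis
    using TC image_events[OF C(1)] relative_sigma_sets_events
    unfolding relative_sets_def by (intro null_closure_idem[of "T ` D" M "T ` C"])
qed

lemma relative_sets_funpow_image: "D \<in> relative_sets A \<Longrightarrow> (T ^^ n) ` D \<in> relative_sets A"
proof (induction n)
  case (Suc n)
  have "(T ^^ Suc n) ` D = T ` ((T ^^ n) ` D)" by auto
  with Suc relative_sets_image show ?case by (simp only:)
qed simp

lemma relative_generatorI:
  assumes "events \<subseteq> relative_sets A"
  shows "relative_generator M T B0 {A, space M - A}"
proof -
  let ?S = "sigma_sets (space M) (sets B0 \<union> two_sided_join M T {A, space M - A})"
  have "two_sided_join M T {A, space M - A} \<subseteq> events"
    unfolding two_sided_join_def using A int_preimage_events
    by (intro sets.sigma_sets_subset) auto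
  then have S: "?S \<subseteq> events"
    using B0_events by (intro sets.sigma_sets_subset) auto
  have "int_preimage M T n A \<in> two_sided_join M T {A, space M - A}" for n
    unfolding two_sided_join_def by (rule sigma_sets.Basic) auto
  then have "sigma_sets (space M) (sets B0 \<union> range (\<lambda>n. int_preimage M T n A)) \<subseteq> ?S"
    by (intro sigma_sets_mono') auto
  then have "relative_sets A \<subseteq> null_closure M ?S"
    unfolding relative_sets_def by (rule null_closure_mono)
  with assms S show ?thesis
    unfolding relative_generator_def by (subst eq_mod_null_sets_iff) auto
qed

end

lemma factor_sets_name:
  assumes "\<And>v. c -` {v} \<inter> space M \<in> factor_sets"
  shows "name c n -` {w} \<inter> space M \<in> factor_sets"
proof (cases "length w = n")
  case True
  have "{x \<in> space M. \<forall>i\<in>{..<n}. c ((T ^^ i) x) = w ! i} \<in> factor_sets"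
  proof (rule factor.sets_Collect_finite_All)
    fix i
    have "{x \<in> space M. c ((T ^^ i) x) = w ! i} = (T ^^ i) -` (c -` {w ! i} \<inter> space M) \<inter> space M"
      using funpow_space by auto
    then show "{x \<in> space M. c ((T ^^ i) x) = w ! i} \<in> factor_sets"
      using factor_sets_funpow_vimage[OF assms] by (simp only:)
  qed simp
  moreover have "name c n x = w \<longleftrightarrow> (\<forall>i\<in>{..<n}. c ((T ^^ i) x) = w ! i)" for x
    using True by (simp add: name_def list_eq_iff_nth_eq lessThan_def)
  then have "name c n -` {w} \<inter> space M = {x \<in> space M. \<forall>i\<in>{..<n}. c ((T ^^ i) x) = w ! i}"
    by blast
  ultimately show ?thesis by (simp only:)
next
  case False
  then have "name c n -` {w} \<inter> space M = {}" by (auto simp: name_def)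
  then show ?thesis by simp
qed

text \<open>If no set of the factor had measure strictly between 0 and \<open>d\<close>, every name
  with positive probability would carry information at most \<open>- ln d\<close>, whatever its
  length, and the entropy of the factor would vanish.\<close>

lemma small_factor_sets:
  assumes "factor_entropy M T B0 > 0" "d > 0"
  obtains E where "E \<in> factor_sets" "0 < prob E" "prob E < d"
proof -
  have "\<exists>E\<in>factor_sets. 0 < prob E \<and> prob E < d"
  proof (rule ccontr)
    assume "\<not> ?thesis"
    then have large: "prob E = 0 \<or> prob E \<ge> d" if "E \<in> factor_sets" for E
      using that by (meson not_less measure_nonneg order_antisym_conv)
    have "ereal (entropy_wrt_partition M T P) \<le> 0" if P: "P \<in> measurable_partitions B0" for P
    proof -
      have "subalgebra M B0" using invariant by (simp add: invariant_subalgebra_def)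
      from this P obtain c :: "'a \<Rightarrow> 'a set" where c: "simple_function M c"
        "\<And>v. c -` {v} \<inter> space M \<in> sets B0" "P = fibres c"
        by (rule measurable_partitionE) blast
      have bound: "label_entropy M (name c n) \<le> - ln d" for n
      proof -
        let ?p = "\<lambda>w. prob (name c n -` {w} \<inter> space M)"
        have nm: "simple_function M (name c n)" using c(1) by (rule simple_function_name)
        have ev: "name c n -` {w} \<inter> space M \<in> factor_sets" for w
          using c(2) B0_factor_sets by (intro factor_sets_name) auto
        have fin: "finite (name c n ` space M)" using nm by (rule simple_functionD)
        have "label_entropy M (name c n) = (\<Sum>w\<in>name c n ` space M. ?p w * - ln (?p w))"
          by (simp add: label_entropy_def sum_negf)
        also have "\<dots> \<le> (\<Sum>w\<in>name c n ` space M. ?p w * - ln d)"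
        proof (rule sum_mono)
          fix w
          show "?p w * - ln (?p w) \<le> ?p w * - ln d"
            using large[OF ev[of w]] \<open>d > 0\<close> by (cases "?p w = 0") (auto intro!: mult_left_mono)
        qed
        also have "\<dots> = (\<Sum>w\<in>name c n ` space M. ?p w) * - ln d"
          by (rule sum_distrib_right[symmetric])
        also have "(\<Sum>w\<in>name c n ` space M. ?p w) = prob (\<Union>w\<in>name c n ` space M. name c n -` {w} \<inter> space M)"
          using fin ev factor_sets_events
          by (intro finite_measure_finite_Union[symmetric]) (auto simp: disjoint_family_on_def)
        also have "(\<Union>w\<in>name c n ` space M. name c n -` {w} \<inter> space M) = space M" by auto
        finally show ?thesis by (simp add: prob_space)
      qed
      have "(\<lambda>n. - ln d / real n) \<longlonglongrightarrow> 0"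
        by (intro tendsto_divide_0[OF tendsto_const] filterlim_real_at_infinity_sequentially)
      then have "entropy_wrt_partition M T (fibres c) \<le> 0"
        using divide_right_mono[OF bound] by (intro LIMSEQ_le[OF entropy_wrt_fibres[OF c(1)]]) auto
      then show ?thesis by (simp add: c(3))
    qed
    then have "factor_entropy M T B0 \<le> 0"
      unfolding factor_entropy_def by (rule SUP_least)
    with assms(1) show False by simp
  qed
  with that show thesis by blast
qed

end


section \<open>Rokhlin towers in a factor\<close>

lemma mod_add_left_inj:
  fixes a b j n :: nat
  assumes "(j + a) mod n = (j + b) mod n" "a < n" "b < n"
  shows "a = b"
proof -
  have "x = y" if "(j + x) mod n = (j + y) mod n" "x < n" "y \<le> x" for x y
  proof -
    have "n dvd (j + x) - (j + y)"
      using that by (intro mod_eq_dvd_iff_nat[THEN iffD1]) auto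
    then have "n dvd x - y" by simp
    moreover have "x - y < n" using that by simp
    ultimately have "x - y = 0" using nat_dvd_not_less by blast
    with that show ?thesis by simp
  qed
  from this[of a b] this[of b a] assms show ?thesis by fastforce
qed

context factor_system
begin

text \<open>The last conclusion is the addition to Rokhlin's lemma: for atypical \<open>Z\<close> it
  bounds by \<open>prob Z\<close> the total mass of the \<open>n\<close> levels standing over bad
  base points.\<close>

lemma factor_tower:
  assumes h: "factor_entropy M T B0 > 0" and n: "n > 0" and e: "e > 0" and Z: "Z \<in> events"
  obtains F where "F \<in> factor_sets"
    "\<And>a b x y. \<lbrakk>a < n; b < n; x \<in> F; y \<in> F; (T ^^ a) x = (T ^^ b) y\<rbrakk> \<Longrightarrow> a = b"
    "prob (space M - (\<Union>i<n. (T ^^ i) ` F)) < e"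
    "real n * prob (F \<inter> Z) \<le> prob Z"
proof -
  \<comment> \<open>The part missed by the tower lies, up to a null set, in \<open>n\<close>
    preimages and \<open>n\<close> images of \<open>E\<close>, whence the factor
    \<open>2 * real n\<close>.\<close>
  have "e / (2 * real n) > 0" using n e by simp
  from small_factor_sets[OF h this] obtain E where
    E: "E \<in> factor_sets" "0 < prob E" "prob E < e / (2 * real n)" by blast
  have EM: "E \<in> events" using E(1) factor_sets_events by blast
  define hit where "hit s x \<longleftrightarrow> (T ^^ s) x \<in> E \<and> (\<forall>i<s. (T ^^ i) x \<notin> E)" for s x
  have hit_unique: "s = s'" if "hit s x" "hit s' x" for s s' x
    using that unfolding hit_def by (metis linorder_neqE_nat)
  have hit_shift: "hit (s - a) ((T ^^ a) x)" if "hit s x" "a \<le> s" for s a x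
  proof -
    have "(T ^^ i) ((T ^^ a) x) = (T ^^ (i + a)) x" for i by (simp add: funpow_add)
    then show ?thesis using that unfolding hit_def by auto
  qed
  have hit_back: "hit (s + i) x" if hs: "hit s ((T ^^ i) x)" and early: "\<And>k. k < i \<Longrightarrow> (T ^^ k) x \<notin> E" for s i x
  proof -
    have *: "(T ^^ j) ((T ^^ i) x) = (T ^^ (j + i)) x" for j by (simp add: funpow_add)
    have "(T ^^ k) x \<notin> E" if "k < s + i" for k
    proof (cases "k < i")
      case False
      then have "(T ^^ (k - i)) ((T ^^ i) x) \<notin> E"
        using \<open>k < s + i\<close> hs by (auto simp: hit_def)
      then show ?thesis using False by (simp add: *)
    qed (rule early)
    with hs show ?thesis unfolding hit_def * by simp
  qed
  txt \<open>Applying \<open>T\<close> lowers the hitting time of \<open>E\<close> by one, so each \<open>F j\<close> is the base of a tower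
    of height \<open>n\<close>. As the \<open>F j\<close> are disjoint, some \<open>F j\<close> meets \<open>Z\<close> in at most its average share.\<close>
  define F where "F j = {x \<in> space M. \<exists>s\<ge>n. s mod n = j \<and> hit s x}" for j
  have hitC: "{x \<in> space M. hit s x} \<in> factor_sets" for s
  proof -
    have *: "{x \<in> space M. (T ^^ i) x \<in> E} \<in> factor_sets" for i
      using factor_sets_funpow_vimage[OF E(1), of i] by (simp add: vimage_def Int_def conj_commute)
    have "{x \<in> space M. \<forall>i\<in>{..<s}. \<not> (T ^^ i) x \<in> E} \<in> factor_sets"
      using * by (intro factor.sets_Collect_finite_All factor.sets_Collect_neg) auto
    from this *[of s] have "{x \<in> space M. (T ^^ s) x \<in> E \<and> (\<forall>i\<in>{..<s}. \<not> (T ^^ i) x \<in> E)} \<in> factor_sets"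
      by (rule factor.sets_Collect_conj)
    then show ?thesis by (simp add: hit_def lessThan_def)
  qed
  have FC: "F j \<in> factor_sets" for j
  proof -
    have "F j = (\<Union>s\<in>{s. s \<ge> n \<and> s mod n = j}. {x \<in> space M. hit s x})"
      by (auto simp: F_def)
    also have "\<dots> \<in> factor_sets"
      using hitC by (intro factor.countable_UN') auto
    finally show ?thesis .
  qed
  have FM: "F j \<in> events" for j using FC factor_sets_events by blast
  have levels: "a = b" if ab: "a < n" "b < n" "x \<in> F j" "y \<in> F j" "(T ^^ a) x = (T ^^ b) y" for a b x y j
  proof -
    from ab obtain s s' where s: "s \<ge> n" "s mod n = j" "hit s x" and s': "s' \<ge> n" "s' mod n = j" "hit s' y"
      by (auto simp: F_def)
    \<comment> \<open>Both sides are the hitting time of the common point. Since hitting times in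
      the base are at least \<open>n\<close>, neither subtraction is truncated.\<close>
    have "s - a = s' - b"
      using hit_shift[OF s(3), of a] hit_shift[OF s'(3), of b] ab s s' hit_unique by auto
    then have "s + b = s' + a" using s s' ab by linarith
    then have "(s + b) mod n = (s' + a) mod n" by simp
    then have "(j + b) mod n = (j + a) mod n"
      using s(2) s'(2) by (metis mod_add_left_eq)
    then show ?thesis using ab mod_add_left_inj[of j b n a] by simp
  qed
  have cover: "prob (space M - (\<Union>i<n. (T ^^ i) ` F j)) < e" if j: "j < n" for j
  proof -
    define U where "U = {x \<in> space M. \<exists>s. (T ^^ s) x \<in> E}"
    have U1: "prob U = 1" unfolding U_def by (rule prob_eventually_hits[OF EM E(2)])
    \<comment> \<open>A set outside the sigma-algebra has \<open>measure\<close> zero by default, so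
      measure one already gives measurability.\<close>
    then have UM: "U \<in> events" using measure_notin_sets by fastforce
    have "space M - (\<Union>i<n. (T ^^ i) ` F j)
        \<subseteq> (space M - U) \<union> ((\<Union>i<n. (T ^^ i) -` E \<inter> space M) \<union> (\<Union>i<n. (T ^^ i) ` E))"
    proof (rule subsetI, rule ccontr)
      fix y assume y: "y \<in> space M - (\<Union>i<n. (T ^^ i) ` F j)"
        and "y \<notin> (space M - U) \<union> ((\<Union>i<n. (T ^^ i) -` E \<inter> space M) \<union> (\<Union>i<n. (T ^^ i) ` E))"
      then have yU: "y \<in> U" and fw: "\<And>i. i < n \<Longrightarrow> (T ^^ i) y \<notin> E"
        and bw: "\<And>i. i < n \<Longrightarrow> y \<notin> (T ^^ i) ` E" by auto
      define s where "s = (LEAST s. (T ^^ s) y \<in> E)"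
      have hs: "hit s y"
        unfolding hit_def s_def using yU LeastI_ex[of "\<lambda>s. (T ^^ s) y \<in> E"] not_less_Least[of _ "\<lambda>s. (T ^^ s) y \<in> E"]
        by (auto simp: U_def)
      have sn: "s \<ge> n" using fw[of s] hs by (auto simp: hit_def not_less[symmetric])
      \<comment> \<open>Going back \<open>i\<close> steps from \<open>y\<close> raises the hitting
        time from \<open>s\<close> to \<open>s + i\<close>, which should be congruent to
        \<open>j\<close>; \<open>n - s mod n\<close> stands for minus \<open>s\<close> in natural
        numbers.\<close>
      define i where "i = (j + (n - s mod n)) mod n"
      have i: "i < n" using n by (simp add: i_def)
      have "(s + i) mod n = (s mod n + (j + (n - s mod n))) mod n"
        by (simp add: i_def mod_simps)
      also have "s mod n + (j + (n - s mod n)) = j + n"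
        using mod_less_divisor[OF n, of s] by linarith
      finally have mod: "(s + i) mod n = j" using j by simp
      have "y \<in> (T ^^ i) ` space M"
        using y funpow_bij[of i] by (simp add: bij_betw_def)
      then obtain x where x: "x \<in> space M" "y = (T ^^ i) x" by auto
      \<comment> \<open>No earlier visit to \<open>E\<close> may shorten the hitting time of
        \<open>x\<close>: such a visit would place \<open>y\<close> in one of the excluded forward
        images of \<open>E\<close>.\<close>
      have "(T ^^ k) x \<notin> E" if "k < i" for k
      proof
        assume "(T ^^ k) x \<in> E"
        moreover have "y = (T ^^ (i - k)) ((T ^^ k) x)"
          using that x(2) by (simp flip: funpow_add comp_apply[of "T ^^ _" "T ^^ _"])
        ultimately have "y \<in> (T ^^ (i - k)) ` E" by (rule image_eqI[rotated])
        then show False using bw[of "i - k"] i by simp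
      qed
      then have "hit (s + i) x" using hs x(2) by (intro hit_back) auto
      then have "x \<in> F j" using x(1) mod sn by (auto simp: F_def intro!: exI[of _ "s + i"])
      then show False using y x(2) i by auto
    qed
    then have "prob (space M - (\<Union>i<n. (T ^^ i) ` F j))
        \<le> prob ((space M - U) \<union> ((\<Union>i<n. (T ^^ i) -` E \<inter> space M) \<union> (\<Union>i<n. (T ^^ i) ` E)))"
      using UM EM by (intro finite_measure_mono sets.Un sets.finite_UN)
        (auto intro: measurable_sets[OF funpow_measurable] funpow_image_events)
    also have "\<dots> \<le> prob (space M - U) + prob ((\<Union>i<n. (T ^^ i) -` E \<inter> space M) \<union> (\<Union>i<n. (T ^^ i) ` E))"
      using UM EM by (intro measure_Un_le sets.Un sets.finite_UN)
        (auto intro: measurable_sets[OF funpow_measurable] funpow_image_events)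
    also have "prob (space M - U) = 0" using prob_compl[OF UM] U1 by simp
    also have "prob ((\<Union>i<n. (T ^^ i) -` E \<inter> space M) \<union> (\<Union>i<n. (T ^^ i) ` E))
        \<le> prob (\<Union>i<n. (T ^^ i) -` E \<inter> space M) + prob (\<Union>i<n. (T ^^ i) ` E)"
      using EM by (intro measure_Un_le sets.finite_UN)
        (auto intro: measurable_sets[OF funpow_measurable] funpow_image_events)
    also have "\<dots> \<le> (\<Sum>i<n. prob ((T ^^ i) -` E \<inter> space M)) + (\<Sum>i<n. prob ((T ^^ i) ` E))"
      using EM by (intro add_mono measure_UNION_le)
        (auto intro: measurable_sets[OF funpow_measurable] funpow_image_events)
    also have "\<dots> = 2 * real n * prob E"
      by (simp add: prob_funpow_vimage prob_funpow_image EM)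
    also have "\<dots> < e" using E(3) n by (simp add: field_simps)
    finally show ?thesis by simp
  qed
  have "\<exists>j<n. real n * prob (F j \<inter> Z) \<le> prob Z"
  proof (rule ccontr)
    assume "\<not> ?thesis"
    then have less: "prob Z < real n * prob (F j \<inter> Z)" if "j < n" for j
      using that by (auto simp: not_le)
    \<comment> \<open>The hitting time of a point is unique, hence so is its residue.\<close>
    have disj: "disjoint_family_on (\<lambda>j. F j \<inter> Z) {..<n}"
      unfolding disjoint_family_on_def F_def using hit_unique by blast
    have "real n * prob Z = (\<Sum>j<n. prob Z)" by simp
    also have "\<dots> < (\<Sum>j<n. real n * prob (F j \<inter> Z))"
      using less n by (intro sum_strict_mono) auto
    also have "\<dots> = real n * prob (\<Union>j<n. F j \<inter> Z)"
      using disj FM Z by (subst finite_measure_finite_Union) (auto simp: sum_distrib_left)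
    also have "\<dots> \<le> real n * prob Z"
      using FM Z by (intro mult_left_mono finite_measure_mono) auto
    finally show False by simp
  qed
  then obtain j where j: "j < n" "real n * prob (F j \<inter> Z) \<le> prob Z" by blast
  show thesis
    by (rule that[OF FC levels cover[OF j(1)] j(2)])
qed


section \<open>Coding names into a set\<close>

text \<open>The bound \<open>exp t \<le> 2 ^ m\<close> makes the subsets of \<open>{..<m}\<close>
  numerous enough to code the typical names, and \<open>m \<le> n\<close> lets the code fit into the
  tower. Overwriting \<open>m\<close> of \<open>n\<close> disjoint levels of equal measure costs at
  most m/n. Decoding can fail only outside the tower or over atypical base points.\<close>

lemma recoverable_from_names:
  fixes c :: "'a \<Rightarrow> 'b"
  assumes h: "factor_entropy M T B0 > 0"
    and c: "simple_function M c" "\<And>v. c -` {v} \<inter> space M \<in> factor_sets"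
    and A: "A \<in> events" and B: "B \<in> events" and g: "0 < g"
    and n: "n > 0" and m: "m \<le> n" "exp t \<le> 2 ^ m"
  defines "G \<equiv> typical (name c n) (name (\<lambda>x. x \<in> B) n) t"
  shows "\<exists>A'\<in>events. prob (sym_diff A A') \<le> real m / real n \<and>
    (\<exists>D\<in>relative_sets A'. prob (sym_diff B D) < g + prob (space M - G))"
proof -
  define X where "X = name c n"
  define Y where "Y = name (\<lambda>x. x \<in> B) n"
  have Xs: "simple_function M X" unfolding X_def using c(1) by (rule simple_function_name)
  have "simple_function M (\<lambda>x. x \<in> B)" using B by (rule simple_function_mem)
  then have Ys: "simple_function M Y" unfolding Y_def by (rule simple_function_name)
  have XY: "(\<lambda>x. (X x, Y x)) \<in> M \<rightarrow>\<^sub>M count_space UNIV"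
    by (intro measurable_simple_function simple_function_Pair Xs Ys)
  have G: "G = typical X Y t" by (simp add: G_def X_def Y_def)
  have GM: "G \<in> events" unfolding G using Xs Ys by (rule typical_measurable)
  from factor_tower[OF h n g sets.compl_sets[OF GM]] obtain F where
    F: "F \<in> factor_sets" and
    levels: "\<And>a b x y. \<lbrakk>a < n; b < n; x \<in> F; y \<in> F; (T ^^ a) x = (T ^^ b) y\<rbrakk> \<Longrightarrow> a = b" and
    cover: "prob (space M - (\<Union>i<n. (T ^^ i) ` F)) < g" and
    bad: "real n * prob (F \<inter> (space M - G)) \<le> prob (space M - G)" by metis
  have FM: "F \<in> events" using F factor_sets_events by blast
  have Fsp: "F \<subseteq> space M" using FM by (rule sets.sets_into_space)
  have same: "a = b \<and> x = y" if "a < n" "b < n" "x \<in> F" "y \<in> F" "(T ^^ a) x = (T ^^ b) y" for a b x y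
  proof -
    have "a = b" using that by (rule levels)
    moreover have "inj_on (T ^^ a) (space M)" using funpow_bij by (auto simp: bij_betw_def)
    ultimately show ?thesis using that Fsp by (auto dest: inj_onD)
  qed
  define Q where "Q u = Y ` (G \<inter> X -` {u})" for u
  have "\<exists>f. f ` Q u \<subseteq> Pow {..<m} \<and> inj_on f (Q u)" for u
  proof (rule card_le_inj)
    show "finite (Q u)" unfolding Q_def G using Xs Ys by (rule card_typical_le(1))
    have "real (card (Q u)) \<le> exp t" unfolding Q_def G using Xs Ys by (rule card_typical_le(2))
    also have "\<dots> \<le> real (2 ^ m)" using m(2) by simp
    finally show "card (Q u) \<le> card (Pow {..<m})" by (simp only: of_nat_le_iff card_Pow finite_lessThan card_lessThan)
  qed simp
  then obtain f where f: "\<And>u. f u ` Q u \<subseteq> Pow {..<m}" "\<And>u. inj_on (f u) (Q u)" by metis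
  have QY: "Y x \<in> Q (X x)" if "x \<in> G" for x using that by (auto simp: Q_def)
  txt \<open>\<open>f u\<close> encodes the typical \<open>B\<close>-names given the \<open>B0\<close>-name \<open>u\<close> as subsets of \<open>{..<m}\<close>.\<close>
  define L where "L i = {x \<in> F \<inter> G. i \<in> f (X x) (Y x)}" for i
  have LM: "L i \<in> events" for i
  proof -
    have "L i = F \<inter> G \<inter> ((\<lambda>x. (X x, Y x)) -` {(u, v). i \<in> f u v} \<inter> space M)"
      using Fsp by (auto simp: L_def)
    moreover have "(\<lambda>x. (X x, Y x)) -` {(u, v). i \<in> f u v} \<inter> space M \<in> events"
      by (rule measurable_sets[OF XY]) simp
    ultimately show ?thesis using FM GM by (simp only: sets.Int)
  qed
  define W where "W = (\<Union>i<m. (T ^^ i) ` F)"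
  have WM: "W \<in> events" unfolding W_def using funpow_image_events[OF FM] by auto
  \<comment> \<open>The old content of the lowest \<open>m\<close> levels is erased completely.
    Since the levels are disjoint, \<open>(T ^^ i) x \<in> A'\<close> then reveals exactly bit
    \<open>i\<close> of the code, whatever \<open>A\<close> was.\<close>
  define A' where "A' = (A - W) \<union> (\<Union>i<m. (T ^^ i) ` L i)"
  have A': "A' \<in> events" unfolding A'_def using A WM funpow_image_events[OF LM] by auto
  have "sym_diff A A' \<subseteq> W" by (auto simp: A'_def W_def L_def)
  then have "prob (sym_diff A A') \<le> prob W" using WM by (rule finite_measure_mono)
  also have "\<dots> \<le> (\<Sum>i<m. prob ((T ^^ i) ` F))"
    unfolding W_def using funpow_image_events[OF FM] by (intro measure_UNION_le) auto
  also have "\<dots> = real m * prob F" by (simp add: prob_funpow_image FM)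
  also have "\<dots> \<le> real m / real n"
  proof -
    have "disjoint_family_on (\<lambda>i. (T ^^ i) ` F) {..<n}"
      unfolding disjoint_family_on_def using levels by blast
    then have "prob (\<Union>i<n. (T ^^ i) ` F) = (\<Sum>i<n. prob ((T ^^ i) ` F))"
      using funpow_image_events[OF FM] by (intro finite_measure_finite_Union) auto
    then have "real n * prob F \<le> 1"
      using prob_le_1[of "\<Union>i<n. (T ^^ i) ` F"] by (simp add: prob_funpow_image FM)
    then have "prob F \<le> 1 / real n" using n by (simp add: field_simps)
    then have "real m * prob F \<le> real m * (1 / real n)" by (rule mult_left_mono) simp
    then show ?thesis by simp
  qed
  finally have close: "prob (sym_diff A A') \<le> real m / real n" .
  have code: "(T ^^ i) x \<in> A' \<longleftrightarrow> i \<in> f (X x) (Y x)" if x: "x \<in> F \<inter> G" and i: "i < m" for x i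
  proof
    assume "(T ^^ i) x \<in> A'"
    moreover have "(T ^^ i) x \<in> W" using x i by (auto simp: W_def)
    ultimately obtain k y where y: "k < m" "y \<in> L k" "(T ^^ i) x = (T ^^ k) y"
      by (auto simp: A'_def)
    then have "i = k \<and> x = y" using x i m(1) by (intro same) (auto simp: L_def)
    with y show "i \<in> f (X x) (Y x)" by (auto simp: L_def)
  next
    assume "i \<in> f (X x) (Y x)"
    with x i show "(T ^^ i) x \<in> A'" by (auto simp: A'_def L_def)
  qed
  define w where "w x = {i\<in>{..<m}. (T ^^ i) x \<in> A'}" for x
  have w_eq: "w x = f (X x) (Y x)" if "x \<in> F \<inter> G" for x
    using code[OF that] f(1)[of "X x"] QY[of x] that unfolding w_def by blast
  interpret R: sigma_algebra "space M" "relative_sets A'"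
    using A' by (rule sigma_algebra_relative_sets)
  have CR: "factor_sets \<subseteq> relative_sets A'" using A' by (rule factor_sets_relative_sets)
  have wR: "{x \<in> space M. w x = S} \<in> relative_sets A'" if "S \<subseteq> {..<m}" for S
  proof -
    have one: "{x \<in> space M. (T ^^ i) x \<in> A'} \<in> relative_sets A'" for i
      using int_preimage_relative_sets[OF A', of "int i"]
      by (simp add: int_preimage_def vimage_def Int_def conj_commute)
    have "{x \<in> space M. \<forall>i\<in>{..<m}. (T ^^ i) x \<in> A' \<longleftrightarrow> i \<in> S} \<in> relative_sets A'"
    proof (intro R.sets_Collect_finite_All)
      fix i
      show "{x \<in> space M. (T ^^ i) x \<in> A' \<longleftrightarrow> i \<in> S} \<in> relative_sets A'"
        using one[of i] R.sets_Collect_neg[OF one[of i]] by (cases "i \<in> S") simp_all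
    qed simp
    moreover have "w x = S \<longleftrightarrow> (\<forall>i\<in>{..<m}. (T ^^ i) x \<in> A' \<longleftrightarrow> i \<in> S)" for x
      using that unfolding w_def by blast
    ultimately show ?thesis by simp
  qed
  \<comment> \<open>The decoder sees only the factor name \<open>u\<close> and the word
    \<open>S\<close>: it looks up a typical name with code \<open>S\<close> and reads position
    \<open>k\<close>. Injectivity of \<open>f u\<close> makes this name unique.\<close>
  define dec where "dec k u S \<longleftrightarrow> (\<exists>v\<in>Q u. f u v = S \<and> v ! k)" for k u S
  define D0 where "D0 k = {x \<in> F. dec k (X x) (w x)}" for k
  have D0R: "D0 k \<in> relative_sets A'" for k
  proof -
    \<comment> \<open>Only finitely many pairs of a factor name and a word occur, so
      \<open>D0 k\<close> is a finite union of sets known to the factor and to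
      \<open>A'\<close>.\<close>
    have "D0 k = (\<Union>(u, S)\<in>{p \<in> X ` space M \<times> Pow {..<m}. dec k (fst p) (snd p)}.
        F \<inter> (X -` {u} \<inter> space M) \<inter> {x \<in> space M. w x = S})"
    proof (intro equalityI subsetI)
      fix x assume x: "x \<in> D0 k"
      then have "(X x, w x) \<in> {p \<in> X ` space M \<times> Pow {..<m}. dec k (fst p) (snd p)}"
        using Fsp by (auto simp: D0_def w_def)
      moreover have "x \<in> F \<inter> (X -` {X x} \<inter> space M) \<inter> {y \<in> space M. w y = w x}"
        using x Fsp by (auto simp: D0_def)
      ultimately show "x \<in> (\<Union>(u, S)\<in>{p \<in> X ` space M \<times> Pow {..<m}. dec k (fst p) (snd p)}.
        F \<inter> (X -` {u} \<inter> space M) \<inter> {x \<in> space M. w x = S})"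
        by (intro UN_I[of "(X x, w x)"]) simp_all
    qed (auto simp: D0_def)
    also have "\<dots> \<in> relative_sets A'"
    proof (rule R.finite_UN)
      show "finite {p \<in> X ` space M \<times> Pow {..<m}. dec k (fst p) (snd p)}"
        using simple_functionD(1)[OF Xs] by simp
      fix p assume "p \<in> {p \<in> X ` space M \<times> Pow {..<m}. dec k (fst p) (snd p)}"
      then have "snd p \<subseteq> {..<m}" by auto
      moreover have "X -` {fst p} \<inter> space M \<in> relative_sets A'"
        unfolding X_def using factor_sets_name[OF c(2)] CR by blast
      ultimately show "(case p of (u, S) \<Rightarrow> F \<inter> (X -` {u} \<inter> space M) \<inter> {x \<in> space M. w x = S}) \<in> relative_sets A'"
        unfolding split_def using F CR by (intro R.Int[OF R.Int] wR) auto
    qed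
    finally show ?thesis .
  qed
  define D where "D = (\<Union>k<n. (T ^^ k) ` D0 k)"
  have DR: "D \<in> relative_sets A'"
    unfolding D_def using relative_sets_funpow_image[OF A' D0R] by auto
  have decode: "(T ^^ k) x \<in> D \<longleftrightarrow> (T ^^ k) x \<in> B" if x: "x \<in> F \<inter> G" and k: "k < n" for x k
  proof -
    have "(T ^^ k) x \<in> D \<longleftrightarrow> x \<in> D0 k"
    proof
      assume "(T ^^ k) x \<in> D"
      then obtain k' y where y: "k' < n" "y \<in> D0 k'" "(T ^^ k) x = (T ^^ k') y"
        by (auto simp: D_def)
      then have "k = k' \<and> x = y" using x k by (intro same) (auto simp: D0_def)
      with y show "x \<in> D0 k" by simp
    qed (use k in \<open>auto simp: D_def\<close>)
    also have "\<dots> \<longleftrightarrow> (\<exists>v\<in>Q (X x). f (X x) v = f (X x) (Y x) \<and> v ! k)"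
      using x w_eq[OF x] by (simp add: D0_def dec_def)
    also have "\<dots> \<longleftrightarrow> Y x ! k"
      using f(2)[of "X x"] QY[of x] x by (auto dest: inj_onD)
    also have "\<dots> \<longleftrightarrow> (T ^^ k) x \<in> B" using k by (simp add: Y_def name_def)
    finally show ?thesis .
  qed
  have DM: "D \<in> events" using DR relative_sets_events[OF A'] by blast
  \<comment> \<open>Over atypical base points the decoder may return anything; their whole columns
    are charged to the error.\<close>
  have "sym_diff B D \<subseteq> (space M - (\<Union>i<n. (T ^^ i) ` F)) \<union> (\<Union>i<n. (T ^^ i) ` (F \<inter> (space M - G)))"
  proof
    fix y assume y: "y \<in> sym_diff B D"
    then have ysp: "y \<in> space M"
      using sets.sets_into_space[OF B] sets.sets_into_space[OF DM] by blast
    show "y \<in> (space M - (\<Union>i<n. (T ^^ i) ` F)) \<union> (\<Union>i<n. (T ^^ i) ` (F \<inter> (space M - G)))"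
    proof (cases "y \<in> (\<Union>i<n. (T ^^ i) ` F)")
      case True
      then obtain k x where k: "k < n" "x \<in> F" "y = (T ^^ k) x" by auto
      then have "x \<notin> G" using decode[of x k] y by blast
      with k Fsp show ?thesis by blast
    qed (use ysp in blast)
  qed
  then have "prob (sym_diff B D)
      \<le> prob ((space M - (\<Union>i<n. (T ^^ i) ` F)) \<union> (\<Union>i<n. (T ^^ i) ` (F \<inter> (space M - G))))"
    using FM GM by (intro finite_measure_mono) (auto intro!: funpow_image_events)
  also have "\<dots> \<le> prob (space M - (\<Union>i<n. (T ^^ i) ` F)) + prob (\<Union>i<n. (T ^^ i) ` (F \<inter> (space M - G)))"
    using FM GM by (intro measure_Un_le) (auto intro!: funpow_image_events)
  also have "prob (\<Union>i<n. (T ^^ i) ` (F \<inter> (space M - G))) \<le> (\<Sum>i<n. prob ((T ^^ i) ` (F \<inter> (space M - G))))"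
    using FM GM by (intro measure_UNION_le) (auto intro!: funpow_image_events)
  also have "\<dots> = real n * prob (F \<inter> (space M - G))"
    using FM GM by (simp add: prob_funpow_image sets.Int sets.Diff)
  finally have "prob (sym_diff B D) < g + prob (space M - G)"
    using cover bad by linarith
  with A' close DR show ?thesis by blast
qed

lemma dense_recoverable:
  assumes h: "factor_entropy M T B0 > 0" and full: "full_entropy M T B0" and fin: "system_entropy M T < \<infinity>"
    and A: "A \<in> events" and B: "B \<in> events" and e: "e > 0"
  shows "\<exists>A'\<in>events. prob (sym_diff A A') < e \<and> (\<exists>D\<in>relative_sets A'. prob (sym_diff B D) < e)"
proof -
  \<comment> \<open>With \<open>t = g * real n\<close>, a mean information of at most
    \<open>g * g * real n\<close> leaves an atypical set of measure at most \<open>g\<close>. The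
    modification of \<open>A\<close> costs at most \<open>3 * g\<close> and the decoding error is
    below \<open>2 * g\<close>, both less than \<open>e\<close>. The cap \<open>1 / 8\<close>
    ensures that \<open>3 * t\<close>, hence \<open>m\<close>, does not exceed
    \<open>n\<close>.\<close>
  define g where "g = min e 1 / 8"
  have g: "0 < g" "g \<le> 1 / 8" "8 * g \<le> e" using e by (auto simp: g_def)
  have "subalgebra M B0" using invariant by (simp add: invariant_subalgebra_def)
  from full_entropy_conditional_names[OF this full fin B, of "g * g"] g(1) obtain c :: "'a \<Rightarrow> 'a set" where
    c: "simple_function M c" "\<And>v. c -` {v} \<inter> space M \<in> sets B0" and
    ev: "\<forall>\<^sub>F n in sequentially. label_entropy M (\<lambda>x. (name c n x, name (\<lambda>x. x \<in> B) n x))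
       - label_entropy M (name c n) \<le> g * g * real n" by auto
  have "\<forall>\<^sub>F n in sequentially. real n \<ge> 1 / g"
    using filterlim_real_sequentially by (auto simp: filterlim_at_top)
  with ev have "\<forall>\<^sub>F n in sequentially. label_entropy M (\<lambda>x. (name c n x, name (\<lambda>x. x \<in> B) n x))
       - label_entropy M (name c n) \<le> g * g * real n \<and> real n \<ge> 1 / g"
    by eventually_elim simp
  then obtain n where n: "label_entropy M (\<lambda>x. (name c n x, name (\<lambda>x. x \<in> B) n x))
       - label_entropy M (name c n) \<le> g * g * real n" "real n \<ge> 1 / g"
    by (auto simp: eventually_sequentially)
  have gn: "g * real n \<ge> 1" using n(2) g(1) by (simp add: field_simps)
  then have n0: "n > 0" by (cases n) auto
  define t where "t = g * real n"
  \<comment> \<open>Two bits per unit of \<open>t\<close> suffice because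
    \<open>ln 2 \<ge> 1 / 2\<close>. As \<open>t \<ge> 1\<close>, rounding up costs at most another
    \<open>t\<close>.\<close>
  define m where "m = nat \<lceil>2 * t\<rceil>"
  have t: "t \<ge> 1" using gn by (simp add: t_def)
  have m_le: "real m \<le> 3 * t" and m_ge: "2 * t \<le> real m"
    unfolding m_def using t by linarith+
  have m3: "real m / real n \<le> 3 * g" using m_le n0 by (simp add: t_def field_simps)
  have "real m \<le> real n"
  proof -
    have "3 * t \<le> real n" unfolding t_def using g(2) n0 by (simp add: field_simps)
    with m_le show ?thesis by linarith
  qed
  then have mn: "m \<le> n" by simp
  have "exp t \<le> exp (real m * ln 2)"
  proof -
    have "ln (2::real) \<ge> 1 / 2"
      using ln_2_less_1 ln_one_minus_pos_upper_bound[of "1/2::real"] by (simp add: ln_div)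
    then have "t \<le> real m * ln 2"
      using m_ge t mult_mono[of "2 * t" "real m" "1/2" "ln 2"] by simp
    then show ?thesis by simp
  qed
  also have "\<dots> = 2 ^ m" by (simp add: exp_of_nat_mult)
  finally have exp_le: "exp t \<le> 2 ^ m" .
  let ?G = "typical (name c n) (name (\<lambda>x. x \<in> B) n) t"
  have Bs: "simple_function M (\<lambda>x. x \<in> B)" using B by (rule simple_function_mem)
  have bad: "prob (space M - ?G) \<le> g"
  proof (rule prob_not_typical_le)
    show "label_entropy M (\<lambda>x. (name c n x, name (\<lambda>x. x \<in> B) n x)) - label_entropy M (name c n) \<le> g * t"
      using n(1) by (simp add: t_def mult.assoc)
  qed (use t c(1) Bs in \<open>auto intro: simple_function_name\<close>)
  have cf: "c -` {v} \<inter> space M \<in> factor_sets" for v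
    using c(2) B0_factor_sets by blast
  from recoverable_from_names[OF h c(1) cf A B g(1) n0 mn exp_le] obtain A' D where
    A': "A' \<in> events" "prob (sym_diff A A') \<le> real m / real n" "D \<in> relative_sets A'"
    "prob (sym_diff B D) < g + prob (space M - ?G)" by blast
  have "prob (sym_diff A A') < e" using A'(2) m3 g by linarith
  moreover have "prob (sym_diff B D) < e" using A'(4) bad g by linarith
  ultimately show ?thesis using A'(1,3) by blast
qed


section \<open>Genericity\<close>

text \<open>The continuity result concerns unsaturated sigma-algebras, so \<open>D\<close> is first
  exchanged for an equivalent generated set \<open>C\<close>; the slack
  \<open>e - prob (sym_diff B C)\<close> is then the admissible perturbation.\<close>

lemma recoverable_open:
  assumes A: "A \<in> events" and B: "B \<in> events" and D: "D \<in> relative_sets A" "prob (sym_diff B D) < e"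
  obtains d where "d > 0"
    "\<And>A'. A' \<in> events \<Longrightarrow> prob (sym_diff A A') < d \<Longrightarrow> \<exists>D'\<in>relative_sets A'. prob (sym_diff B D') < e"
proof -
  from D(1) obtain C where C: "D \<in> events" "sym_diff D C \<in> null_sets M"
    "C \<in> sigma_sets (space M) (sets B0 \<union> range (\<lambda>n. int_preimage M T n A))"
    unfolding relative_sets_def by (rule null_closureE) blast
  have CM: "C \<in> events" using C(3) relative_sigma_sets_events[OF A] by blast
  have "prob (sym_diff D C) = 0" using C(2) by (auto simp: measure_def null_setsD1)
  then have "prob (sym_diff B C) < e"
    using prob_sym_diff_triangle[OF B C(1) CM] D(2) by linarith
  then have "e - prob (sym_diff B C) > 0" by simp
  have "\<exists>d>0. \<forall>A'\<in>events. prob (sym_diff A A') < d \<longrightarrow>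
    (\<exists>D'\<in>sigma_sets (space M) (sets B0 \<union> range (\<lambda>n. int_preimage M T n A')).
      prob (sym_diff C D') < e - prob (sym_diff B C))"
  proof (rule sigma_sets_approx_continuous[where G = "int_preimage M T", OF B0_events _ _ A C(3)])
    show "prob (sym_diff (int_preimage M T i A1) (int_preimage M T i A2)) \<le> prob (sym_diff A1 A2)"
      if "A1 \<in> events" "A2 \<in> events" for i A1 A2
    proof -
      have "sym_diff A1 A2 \<in> events" using that by auto
      then show ?thesis
        unfolding int_preimage_sym_diff[OF that[THEN sets.sets_into_space]]
        by (simp only: prob_int_preimage order_refl)
    qed
  qed (use \<open>e - prob (sym_diff B C) > 0\<close> in \<open>auto intro: int_preimage_events\<close>)
  then obtain d where d: "d > 0" "\<And>A'. A' \<in> events \<Longrightarrow> prob (sym_diff A A') < d \<Longrightarrow>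
    (\<exists>D'\<in>sigma_sets (space M) (sets B0 \<union> range (\<lambda>n. int_preimage M T n A')).
      prob (sym_diff C D') < e - prob (sym_diff B C))" by blast
  show thesis
  proof (rule that[OF d(1)])
    fix A' assume A': "A' \<in> events" "prob (sym_diff A A') < d"
    from d(2)[OF this] obtain D' where
      D': "D' \<in> sigma_sets (space M) (sets B0 \<union> range (\<lambda>n. int_preimage M T n A'))"
        "prob (sym_diff C D') < e - prob (sym_diff B C)" by blast
    have "D' \<in> events" using D'(1) relative_sigma_sets_events[OF A'(1)] by blast
    from prob_sym_diff_triangle[OF B CM this] D'(2) have "prob (sym_diff B D') < e" by linarith
    moreover have "D' \<in> relative_sets A'"
      unfolding relative_sets_def using D'(1) subset_null_closure[OF relative_sigma_sets_events[OF A'(1)]] by blast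
    ultimately show "\<exists>D'\<in>relative_sets A'. prob (sym_diff B D') < e" by blast
  qed
qed

text \<open>Quantifying over all representatives makes the condition a property of the class, with
  no choice involved.\<close>

definition recovering :: "'a set \<Rightarrow> real \<Rightarrow> 'a set set set" where
  "recovering B e =
    {a \<in> measure_algebra M. \<forall>A\<in>a. \<exists>D\<in>relative_sets A. prob (sym_diff B D) < e}"

lemma measure_algebra_cases:
  assumes "a \<in> measure_algebra M"
  obtains A where "A \<in> events" "A \<in> a" "a = null_equiv M `` {A}"
proof -
  from assms obtain A where A: "A \<in> events" "a = null_equiv M `` {A}"
    unfolding measure_algebra_def by (rule quotientE)
  moreover from A have "A \<in> a" by (simp add: null_equiv_iff)
  ultimately show thesis using that by blast
qed

lemma measure_algebra_mem:
  assumes "A \<in> events" "A' \<in> null_equiv M `` {A}"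
  shows "A' \<in> events" "prob (sym_diff A A') = 0"
proof -
  show "A' \<in> events" using assms by (auto simp: null_equiv_def)
  with assms show "prob (sym_diff A A') = 0" by (simp add: null_equiv_iff)
qed

text \<open>One good representative suffices, even for nearby classes: all members of a class are at
  the same distance from \<open>A\<close>, so \<open>recoverable_open\<close> applies to each of
  them.\<close>

lemma recoveringI:
  assumes A: "A \<in> events" and B: "B \<in> events" and D: "D \<in> relative_sets A" "prob (sym_diff B D) < e"
  obtains d where "d > 0"
    "\<And>A'. A' \<in> events \<Longrightarrow> prob (sym_diff A A') < d \<Longrightarrow> null_equiv M `` {A'} \<in> recovering B e"
proof -
  from recoverable_open[OF assms] obtain d where d: "d > 0"
    "\<And>A'. A' \<in> events \<Longrightarrow> prob (sym_diff A A') < d \<Longrightarrow> \<exists>D'\<in>relative_sets A'. prob (sym_diff B D') < e"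
    by metis
  show thesis
  proof (rule that[OF d(1)])
    fix A' assume A': "A' \<in> events" "prob (sym_diff A A') < d"
    have "null_equiv M `` {A'} \<in> measure_algebra M"
      unfolding measure_algebra_def using A'(1) by (rule quotientI)
    moreover have "\<exists>D\<in>relative_sets A''. prob (sym_diff B D) < e" if "A'' \<in> null_equiv M `` {A'}" for A''
    proof (rule d(2))
      note A'' = measure_algebra_mem[OF A'(1) that]
      show "A'' \<in> events" by (rule A''(1))
      show "prob (sym_diff A A'') < d"
        using prob_sym_diff_triangle[OF A A'(1) A''(1)] A''(2) A'(2) by linarith
    qed
    ultimately show "null_equiv M `` {A'} \<in> recovering B e"
      by (simp add: recovering_def)
  qed
qed

sublocale measure_algebra: Metric_space "measure_algebra M" "measure_algebra_dist M"
  by (rule Metric_space_measure_algebra)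

lemma openin_recovering:
  assumes B: "B \<in> events"
  shows "openin measure_algebra.mtopology (recovering B e)"
  unfolding measure_algebra.openin_mtopology
proof (intro conjI allI impI)
  fix a assume a: "a \<in> recovering B e"
  then have "a \<in> measure_algebra M" by (simp add: recovering_def)
  then obtain A where A: "A \<in> events" "A \<in> a" "a = null_equiv M `` {A}"
    by (rule measure_algebra_cases)
  from a A(2) obtain D where "D \<in> relative_sets A" "prob (sym_diff B D) < e"
    by (auto simp: recovering_def)
  from recoveringI[OF A(1) B this] obtain d where d: "d > 0"
    "\<And>A'. A' \<in> events \<Longrightarrow> prob (sym_diff A A') < d \<Longrightarrow> null_equiv M `` {A'} \<in> recovering B e"
    by metis
  have "measure_algebra.mball a d \<subseteq> recovering B e"
  proof
    fix a' assume "a' \<in> measure_algebra.mball a d"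
    then have a': "a' \<in> measure_algebra M" "measure_algebra_dist M a a' < d" by auto
    from a'(1) obtain A' where A': "A' \<in> events" "A' \<in> a'" "a' = null_equiv M `` {A'}"
      by (rule measure_algebra_cases)
    then show "a' \<in> recovering B e"
      using a'(2) A d(2) measure_algebra_dist_class by simp
  qed
  with d(1) show "\<exists>r>0. measure_algebra.mball a r \<subseteq> recovering B e" by blast
qed (auto simp: recovering_def)

lemma dense_recovering:
  assumes h: "factor_entropy M T B0 > 0" and full: "full_entropy M T B0" and fin: "system_entropy M T < \<infinity>"
    and B: "B \<in> events" and e: "e > 0"
  shows "measure_algebra.mtopology closure_of recovering B e = measure_algebra M"
  unfolding measure_algebra.metric_closure_of
proof (intro equalityI subsetI CollectI conjI allI impI)
  fix a and r :: real assume a: "a \<in> measure_algebra M" and r: "r > 0"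
  from a obtain A where A: "A \<in> events" "A \<in> a" "a = null_equiv M `` {A}"
    by (rule measure_algebra_cases)
  have "min e r > 0" using e r by simp
  from dense_recoverable[OF h full fin A(1) B this] obtain A' D where
    A': "A' \<in> events" "prob (sym_diff A A') < r" "D \<in> relative_sets A'" "prob (sym_diff B D) < e"
    by auto
  from recoveringI[OF A'(1) B A'(3,4)] obtain d where
    "d > 0" "\<And>A''. A'' \<in> events \<Longrightarrow> prob (sym_diff A' A'') < d \<Longrightarrow> null_equiv M `` {A''} \<in> recovering B e"
    by metis
  then have R: "null_equiv M `` {A'} \<in> recovering B e" using A'(1) by simp
  moreover have "null_equiv M `` {A'} \<in> measure_algebra M" using R by (simp add: recovering_def)
  ultimately show "\<exists>y\<in>recovering B e. y \<in> measure_algebra.mball a r"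
    using a A A'(1,2) measure_algebra_dist_class by (intro bexI[of _ "null_equiv M `` {A'}"]) simp_all
qed auto

text \<open>The witness is the intersection of the countably many sets
  \<open>recovering (G k) (inverse (real (Suc j)))\<close>, to which completeness of the measure
  algebra lets Baire's theorem apply. For \<open>A\<close> in one of its classes, closedness of
  \<open>relative_sets A\<close> upgrades approximation of each \<open>G k\<close> at every
  precision to membership.\<close>

lemma generic_relative_generator:
  assumes std: "standard_prob_space M"
    and h: "factor_entropy M T B0 > 0" and full: "full_entropy M T B0" and fin: "system_entropy M T < \<infinity>"
  shows "generic_in measure_algebra.mtopology
    {a \<in> measure_algebra M. \<forall>A\<in>a. relative_generator M T B0 {A, space M - A}}"
proof -
  from std obtain G :: "nat \<Rightarrow> 'a set" where G: "range G \<subseteq> events"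
    "events \<subseteq> null_closure M (sigma_sets (space M) (range G))"
    by (rule standard_prob_space_countably_generated)
  define \<U> where "\<U> = (\<lambda>(k, j). recovering (G k) (inverse (real (Suc j)))) ` (UNIV :: (nat \<times> nat) set)"
  have \<U>: "countable \<U>" "\<U> \<noteq> {}" by (auto simp: \<U>_def)
  have op: "openin measure_algebra.mtopology U" if "U \<in> \<U>" for U
    using that G(1) openin_recovering by (auto simp: \<U>_def)
  have dn: "measure_algebra.mtopology closure_of U = measure_algebra M" if "U \<in> \<U>" for U
    using that G(1) dense_recovering[OF h full fin] by (auto simp: \<U>_def)
  have "measure_algebra.mtopology closure_of \<Inter> \<U> = measure_algebra M"
    using mcomplete_measure_algebra \<U>(1) op dn by (intro measure_algebra.metric_Baire_category) auto
  moreover have "gdelta_in measure_algebra.mtopology (\<Inter> \<U>)"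
    using \<U> op by (intro gdelta_in_Inter open_imp_gdelta_in)
  moreover have "\<Inter> \<U> \<subseteq> {a \<in> measure_algebra M. \<forall>A\<in>a. relative_generator M T B0 {A, space M - A}}"
  proof (intro subsetI CollectI conjI ballI)
    fix a assume a: "a \<in> \<Inter> \<U>"
    then have aR: "a \<in> recovering (G k) (inverse (real (Suc j)))" for k j
      by (auto simp: \<U>_def)
    then show aM: "a \<in> measure_algebra M" by (auto simp: recovering_def)
    fix A assume Aa: "A \<in> a"
    with aM have A: "A \<in> events"
      by (metis measure_algebra_cases measure_algebra_mem(1))
    interpret R: sigma_algebra "space M" "relative_sets A" using A by (rule sigma_algebra_relative_sets)
    have "G k \<in> relative_sets A" for k
      unfolding relative_sets_def
    proof (rule null_closure_closed[OF relative_sigma_algebra[OF A] relative_sigma_sets_events[OF A]])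
      show "G k \<in> events" using G(1) by auto
      fix e :: real assume "e > 0"
      then obtain j where "inverse (real (Suc j)) < e" using reals_Archimedean by blast
      moreover from aR[of k j] Aa obtain D where "D \<in> relative_sets A" "prob (sym_diff (G k) D) < inverse (real (Suc j))"
        by (auto simp: recovering_def)
      ultimately show "\<exists>D\<in>null_closure M (sigma_sets (space M) (sets B0 \<union> range (\<lambda>n. int_preimage M T n A))).
          prob (sym_diff (G k) D) < e"
        unfolding relative_sets_def[symmetric] by (intro bexI[of _ D]) auto
    qed
    then have sub: "sigma_sets (space M) (range G) \<subseteq> relative_sets A"
      by (intro R.sigma_sets_subset) auto
    have "events \<subseteq> relative_sets A"
    proof
      fix B assume "B \<in> events"
      with G(2) obtain C where "B \<in> events" "C \<in> sigma_sets (space M) (range G)" "sym_diff B C \<in> null_sets M"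
        by (blast elim: null_closureE)
      with sub show "B \<in> relative_sets A"
        using relative_sigma_sets_events[OF A] unfolding relative_sets_def
        by (intro null_closure_idem[of B M C]) auto
    qed
    with A show "relative_generator M T B0 {A, space M - A}" by (rule relative_generatorI)
  qed
  ultimately show ?thesis unfolding generic_in_def by auto
qed

end

theorem theorem7:
  fixes M B0 :: "'a measure" and T :: "'a \<Rightarrow> 'a"
  assumes "standard_prob_space M"
    and "ergodic_system M T"
    and "0 < system_entropy M T" and "system_entropy M T < \<infinity>"
    and "invariant_subalgebra M T B0"
    and "full_entropy M T B0"
  shows "generic_in (measure_algebra_topology M)
    {a \<in> measure_algebra M. \<forall>A\<in>a. relative_generator M T B0 {A, space M - A}}"
proof -
  interpret factor_system M T B0
    using assms(2,5) by (simp add: factor_system_def factor_system_axioms_def)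
  \<comment> \<open>Full entropy transfers positivity to the factor, which thereby has the small
    sets that the towers require.\<close>
  have "factor_entropy M T B0 > 0"
    using assms(3,6) by (simp add: full_entropy_def)
  from generic_relative_generator[OF assms(1) this assms(6,4)] show ?thesis
    unfolding measure_algebra_topology_def .
qed

end
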